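(* Let $X,Y$ be compact Hausdorff spaces and $E$ a Banach space over $\mathbb K$. Let $A(X,E)$ be a subspace of $C(X,E)$ containing all constant functions, and let $A(X)$ be a regular Banach function algebra on $X$ such that $A(X)\cdot A(X,E)\subseteq A(X,E)$. Assume, furthermore, that $(A(X,E),\|\cdot\|_\infty)$ has property (P). Then for any pair $T,S:A(X,E)\to C(Y)$ of jointly separating linear operators there exist a partition $\{Y_0,Y_c,Y_d\}$ of $Y$ (members may be empty), where $Y_0$ is closed in $Y$ and $Y_d$ is open in $Y$, a continuous map $\phi:Y_c\cup Y_d\to X$, and maps $\Lambda^T,\Lambda^S:Y_c\to E^*$, $y\mapsto\Lambda^T_y$, $y\mapsto\Lambda^S_y$, such that $$Tf(y)=\Lambda^T_y\big(f(\phi(y))\big)\qquad(f\in A(X,E),\ y\in Y_c)$$ and $$Sf(y)=\Lambda^S_y\big(f(\phi(y))\big)\qquad(f\in A(X,E),\ y\in Y_c).$$ In particular, if $T$ and $S$ are continuous (with respect to the supremum norms), then, for this partition, $Y_d=\emptyset$ and $$Y_c=\Big(\bigcup_{f\in A(X,E)}\mathrm{coz}(Tf)\Big)\cap\Big(\bigcup_{f\in A(X,E)}\mathrm{coz}(Sf)\Big).$$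
   Context: $\mathbb K$ is $\mathbb R$ or $\mathbb C$. $C(X,E)$ is the space of all continuous functions $X\to E$ with the supremum norm $\|\cdot\|_\infty$; $C(Y)$ is the space of continuous complex-valued functions on $Y$; $E^*$ is the dual space of $E$. For a function $f$, $\mathrm{coz}(f)=\{x: f(x)\neq 0\}$. A Banach function algebra on $X$ is a complex subalgebra $A(X)$ of the algebra of continuous complex-valued functions on $X$ that contains the constants, separates the points of $X$, and is a Banach algebra under some norm. It is regular if for every closed subset $K$ of its maximal ideal space and every $\varphi\notin K$ in the maximal ideal space there is $f\in A(X)$ whose Gelfand transform satisfies $\widehat f(\varphi)=1$ and $\widehat f=0$ on $K$. $A(X)\cdot A(X,E)=\{f\cdot h:f\in A(X),h\in A(X,E)\}$, where $(f\cdot h)(x)=f(x)h(x)$. Property (P) for $(A(X,E),\|\cdot\|)$, where $\|\cdot\|\ge\|\cdot\|_\infty$: for each $f\in A(X,E)$ and $x\in X$ with $f(x)=0$ there is a sequence $\{f_n\}$ in $A(X,E)$ such that each $f_n$ vanishes on a neighborhood of $x$ and $\|f_n-f\|\to0$. Linear operators $T,S:A(X,E)\to C(Y)$ are jointly separating if $\mathrm{coz}(Tf)\cap\mathrm{coz}(Sg)=\emptyset$ for all $f,g\in A(X,E)$ with $\mathrm{coz}(f)\cap\mathrm{coz}(g)=\emptyset$.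
   Formalization: Only 𝕂 = ℂ is treated: A(X) is a complex algebra containing the constant i and C(Y) is complex-valued, so for a real Banach space E the products in A(X)·A(X,E) are undefined; E, its dual, subspaces and linear operators are all taken over ℂ. *)

theory Defs
  imports "HOL-Analysis.Analysis"
begin

section \<open>Complex Banach spaces\<close>

text \<open>
  The libraries provide \<^class>\<open>real_normed_vector\<close> and \<^class>\<open>banach\<close> only. The complex versions
  are obtained by adding a complex scalar multiplication that extends the real one.
\<close>

class complex_normed_vector = real_normed_vector +
  fixes scaleC :: "complex \<Rightarrow> 'a \<Rightarrow> 'a" (infixr "*\<^sub>C" 75)
  assumes scaleC_add_right: "c *\<^sub>C (x + y) = c *\<^sub>C x + c *\<^sub>C y"
    and scaleC_add_left: "(c + d) *\<^sub>C x = c *\<^sub>C x + d *\<^sub>C x"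
    and scaleC_scaleC: "c *\<^sub>C (d *\<^sub>C x) = (c * d) *\<^sub>C x"
    and scaleC_of_real: "complex_of_real r *\<^sub>C x = r *\<^sub>R x"
    and norm_scaleC: "norm (c *\<^sub>C x) = norm c * norm x"

class complex_banach = complex_normed_vector + banach

instantiation complex :: complex_banach
begin

definition scaleC_complex :: "complex \<Rightarrow> complex \<Rightarrow> complex"
  where "scaleC_complex c z = c * z"

instance
  by standard (simp_all add: scaleC_complex_def distrib_left distrib_right norm_mult
      scaleR_conv_of_real)

end

lemma scaleC_one: "1 *\<^sub>C (x::'a::complex_normed_vector) = x"
  using scaleC_of_real[of 1 x] by simp

global_interpretation complex_vector:
  vector_space "scaleC :: complex \<Rightarrow> 'a::complex_normed_vector \<Rightarrow> 'a"
  by standard (simp_all add: scaleC_add_right scaleC_add_left scaleC_scaleC scaleC_one)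

lemma bounded_bilinear_scaleC:
  "bounded_bilinear (scaleC :: complex \<Rightarrow> 'a::complex_normed_vector \<Rightarrow> 'a)"
proof
  fix c d :: complex and x y :: 'a and r :: real
  show "(c + d) *\<^sub>C x = c *\<^sub>C x + d *\<^sub>C x" by (rule scaleC_add_left)
  show "c *\<^sub>C (x + y) = c *\<^sub>C x + c *\<^sub>C y" by (rule scaleC_add_right)
  show "(r *\<^sub>R c) *\<^sub>C x = r *\<^sub>R (c *\<^sub>C x)"
    by (simp add: scaleR_conv_of_real scaleC_scaleC flip: scaleC_of_real)
  show "c *\<^sub>C (r *\<^sub>R x) = r *\<^sub>R (c *\<^sub>C x)"
    by (simp add: scaleC_scaleC mult.commute flip: scaleC_of_real)
  show "\<exists>K. \<forall>c (x::'a). norm (c *\<^sub>C x) \<le> norm c * norm x * K"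
    by (rule exI[of _ 1]) (simp add: norm_scaleC)
qed

definition clinear_on :: "'a::complex_normed_vector set \<Rightarrow> ('a \<Rightarrow> 'b::complex_normed_vector) \<Rightarrow> bool"
  where "clinear_on M T \<longleftrightarrow>
    (\<forall>f\<in>M. \<forall>g\<in>M. T (f + g) = T f + T g) \<and> (\<forall>c. \<forall>f\<in>M. T (c *\<^sub>C f) = c *\<^sub>C T f)"

definition dual_space :: "('e::complex_normed_vector \<Rightarrow> complex) set"
  where "dual_space = {l. clinear_on UNIV l \<and> continuous_on UNIV l}"


section \<open>Continuous functions on a compact space\<close>

text \<open>
  If \<open>UNIV :: 'x set\<close> is compact, then \<open>'x \<Rightarrow>\<^sub>C 'e\<close>, the type of bounded continuous functions
  with the supremum norm, is the space of all continuous functions from \<open>'x\<close> to \<open>'e\<close>.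
\<close>

text \<open>
  Pointwise product of a scalar function and a vector-valued function; at \<open>'e = complex\<close> it is
  the product of the algebra of continuous complex functions.
\<close>

definition pmult ::
  "('x::topological_space \<Rightarrow>\<^sub>C complex) \<Rightarrow> ('x \<Rightarrow>\<^sub>C 'e::complex_normed_vector) \<Rightarrow> ('x \<Rightarrow>\<^sub>C 'e)"
    (infixl "\<bullet>\<^sub>C" 70)
  where "f \<bullet>\<^sub>C h = Bcontfun (\<lambda>x. apply_bcontfun f x *\<^sub>C apply_bcontfun h x)"

lemma apply_pmult: "apply_bcontfun (f \<bullet>\<^sub>C h) x = apply_bcontfun f x *\<^sub>C apply_bcontfun h x"
  for f :: "'x::topological_space \<Rightarrow>\<^sub>C complex" and h :: "'x \<Rightarrow>\<^sub>C 'e::complex_normed_vector"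
proof -
  have "(\<lambda>x. apply_bcontfun f x *\<^sub>C apply_bcontfun h x) \<in> bcontfun"
  proof (rule bcontfun_normI)
    show "continuous_on UNIV (\<lambda>x. apply_bcontfun f x *\<^sub>C apply_bcontfun h x)"
      by (intro bounded_bilinear.continuous_on[OF bounded_bilinear_scaleC]
          continuous_on_apply_bcontfun)
    show "norm (apply_bcontfun f x *\<^sub>C apply_bcontfun h x) \<le> norm f * norm h" for x
      unfolding norm_scaleC by (intro mult_mono norm_bounded norm_ge_zero)
  qed
  then show ?thesis
    by (simp add: pmult_def Bcontfun_inverse)
qed

instantiation bcontfun :: (topological_space, complex_normed_vector) complex_normed_vector
begin

definition scaleC_bcontfun :: "complex \<Rightarrow> ('a \<Rightarrow>\<^sub>C 'b) \<Rightarrow> ('a \<Rightarrow>\<^sub>C 'b)"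
  where "scaleC_bcontfun c f = const_bcontfun c \<bullet>\<^sub>C f"

lemma apply_scaleC_bcontfun: "apply_bcontfun (c *\<^sub>C f) x = c *\<^sub>C apply_bcontfun f x"
  for f :: "'a \<Rightarrow>\<^sub>C 'b"
  by (simp add: scaleC_bcontfun_def apply_pmult const_bcontfun.rep_eq)

instance
proof
  fix c d :: complex and f g :: "'a \<Rightarrow>\<^sub>C 'b" and r :: real
  show "c *\<^sub>C (f + g) = c *\<^sub>C f + c *\<^sub>C g"
    by (rule bcontfun_eqI) (simp add: apply_scaleC_bcontfun scaleC_add_right)
  show "(c + d) *\<^sub>C f = c *\<^sub>C f + d *\<^sub>C f"
    by (rule bcontfun_eqI) (simp add: apply_scaleC_bcontfun scaleC_add_left)
  show "c *\<^sub>C (d *\<^sub>C f) = (c * d) *\<^sub>C f"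
    by (rule bcontfun_eqI) (simp add: apply_scaleC_bcontfun scaleC_scaleC)
  show "complex_of_real r *\<^sub>C f = r *\<^sub>R f"
    by (rule bcontfun_eqI) (simp add: apply_scaleC_bcontfun scaleC_of_real)
  have le: "norm (e *\<^sub>C h) \<le> norm e * norm h" for e and h :: "'a \<Rightarrow>\<^sub>C 'b"
    by (rule norm_bound) (simp add: apply_scaleC_bcontfun norm_scaleC mult_left_mono norm_bounded)
  show "norm (c *\<^sub>C f) = norm c * norm f"
  proof (cases "c = 0")
    case True
    then show ?thesis using le[of c f] by simp
  next
    case False
    then have "f = inverse c *\<^sub>C (c *\<^sub>C f)"
      by (intro bcontfun_eqI) (simp add: apply_scaleC_bcontfun scaleC_scaleC scaleC_one)
    then have "norm f \<le> norm (inverse c) * norm (c *\<^sub>C f)"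
      using le[of "inverse c" "c *\<^sub>C f"] by simp
    then have "norm c * norm f \<le> norm (c *\<^sub>C f)"
      using False by (simp add: norm_divide field_simps)
    with le[of c f] show ?thesis by simp
  qed
qed

end

definition coz :: "('x::topological_space \<Rightarrow>\<^sub>C 'e::real_normed_vector) \<Rightarrow> 'x set"
  where "coz f = {x. apply_bcontfun f x \<noteq> 0}"


section \<open>Regular Banach function algebras\<close>

definition banach_algebra_norm_on ::
  "('x::topological_space \<Rightarrow>\<^sub>C complex) set \<Rightarrow> (('x \<Rightarrow>\<^sub>C complex) \<Rightarrow> real) \<Rightarrow> bool"
  where "banach_algebra_norm_on A N \<longleftrightarrow>
    (\<forall>f\<in>A. 0 \<le> N f \<and> (N f = 0 \<longleftrightarrow> f = 0)) \<and>
    (\<forall>f\<in>A. \<forall>g\<in>A. N (f + g) \<le> N f + N g) \<and>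
    (\<forall>c. \<forall>f\<in>A. N (c *\<^sub>C f) = norm c * N f) \<and>
    (\<forall>f\<in>A. \<forall>g\<in>A. N (f \<bullet>\<^sub>C g) \<le> N f * N g) \<and>
    (\<forall>F::nat \<Rightarrow> 'x \<Rightarrow>\<^sub>C complex. range F \<subseteq> A \<longrightarrow>
       (\<forall>e>0. \<exists>n0. \<forall>m\<ge>n0. \<forall>n\<ge>n0. N (F m - F n) < e) \<longrightarrow>
       (\<exists>f\<in>A. (\<lambda>n. N (F n - f)) \<longlonglongrightarrow> 0))"

definition banach_function_algebra :: "('x::topological_space \<Rightarrow>\<^sub>C complex) set \<Rightarrow> bool"
  where "banach_function_algebra A \<longleftrightarrow>
    complex_vector.subspace A \<and>
    (\<forall>f\<in>A. \<forall>g\<in>A. f \<bullet>\<^sub>C g \<in> A) \<and>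
    (\<forall>c. const_bcontfun c \<in> A) \<and>
    (\<forall>x y. x \<noteq> y \<longrightarrow> (\<exists>f\<in>A. apply_bcontfun f x \<noteq> apply_bcontfun f y)) \<and>
    (\<exists>N. banach_algebra_norm_on A N)"

text \<open>
  The maximal ideal space is the set of nonzero multiplicative linear functionals on \<open>A\<close> with the
  Gelfand topology, the topology of pointwise convergence on \<open>A\<close>. Functionals are made
  \<^const>\<open>extensional\<close> so that each one is represented by exactly one HOL function.
\<close>

definition characters ::
  "('x::topological_space \<Rightarrow>\<^sub>C complex) set \<Rightarrow> (('x \<Rightarrow>\<^sub>C complex) \<Rightarrow> complex) set"
  where "characters A = {\<phi> \<in> extensional A. clinear_on A \<phi> \<and>
    (\<forall>f\<in>A. \<forall>g\<in>A. \<phi> (f \<bullet>\<^sub>C g) = \<phi> f * \<phi> g) \<and> (\<exists>f\<in>A. \<phi> f \<noteq> 0)}"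

definition maximal_ideal_space ::
  "('x::topological_space \<Rightarrow>\<^sub>C complex) set \<Rightarrow> (('x \<Rightarrow>\<^sub>C complex) \<Rightarrow> complex) topology"
  where "maximal_ideal_space A =
    subtopology (product_topology (\<lambda>f. euclidean) A) (characters A)"

definition gelfand_transform ::
  "('x::topological_space \<Rightarrow>\<^sub>C complex) \<Rightarrow> (('x \<Rightarrow>\<^sub>C complex) \<Rightarrow> complex) \<Rightarrow> complex"
  where "gelfand_transform f \<phi> = \<phi> f"

definition regular_banach_function_algebra :: "('x::topological_space \<Rightarrow>\<^sub>C complex) set \<Rightarrow> bool"
  where "regular_banach_function_algebra A \<longleftrightarrow>
    banach_function_algebra A \<and>
    (\<forall>K \<phi>. closedin (maximal_ideal_space A) K \<longrightarrow>
       \<phi> \<in> topspace (maximal_ideal_space A) - K \<longrightarrow>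
       (\<exists>f\<in>A. gelfand_transform f \<phi> = 1 \<and> (\<forall>\<psi>\<in>K. gelfand_transform f \<psi> = 0)))"

lemma topspace_maximal_ideal_space: "topspace (maximal_ideal_space A) = characters A"
  by (auto simp: maximal_ideal_space_def characters_def PiE_def)


section \<open>Property (P) and jointly separating operators\<close>

definition property_P ::
  "('x::topological_space \<Rightarrow>\<^sub>C 'e::real_normed_vector) set \<Rightarrow> (('x \<Rightarrow>\<^sub>C 'e) \<Rightarrow> real) \<Rightarrow> bool"
  where "property_P M N \<longleftrightarrow>
    (\<forall>f\<in>M. \<forall>x. apply_bcontfun f x = 0 \<longrightarrow>
       (\<exists>F::nat \<Rightarrow> 'x \<Rightarrow>\<^sub>C 'e.
          (\<forall>n. F n \<in> M \<and> (\<exists>U. open U \<and> x \<in> U \<and> (\<forall>z\<in>U. apply_bcontfun (F n) z = 0))) \<and>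
          (\<lambda>n. N (F n - f)) \<longlonglongrightarrow> 0))"

definition jointly_separating ::
  "('x::topological_space \<Rightarrow>\<^sub>C 'e::real_normed_vector) set \<Rightarrow>
   (('x \<Rightarrow>\<^sub>C 'e) \<Rightarrow> ('y::topological_space \<Rightarrow>\<^sub>C complex)) \<Rightarrow>
   (('x \<Rightarrow>\<^sub>C 'e) \<Rightarrow> ('y \<Rightarrow>\<^sub>C complex)) \<Rightarrow> bool"
  where "jointly_separating M T S \<longleftrightarrow>
    (\<forall>f\<in>M. \<forall>g\<in>M. coz f \<inter> coz g = {} \<longrightarrow> coz (T f) \<inter> coz (S g) = {})"

end

theory Submission
  imports Defs
begin

text \<open>
  For \<open>y\<close> with \<open>f \<mapsto> T f y\<close> and \<open>g \<mapsto> S g y\<close> both nonzero, the functions \<open>a \<in> A\<close> with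
  \<open>T (a h) y = 0\<close> for all \<open>h\<close> form a proper ideal of \<open>A\<close>. A proper ideal of a commutative Banach algebra
  is killed by a character (Zorn and Gelfand--Mazur), and by regularity every character of \<open>A\<close>
  is a point evaluation; so the ideal has a common zero \<open>x\<close>, and \<open>f \<mapsto> T f y\<close> is nonzero on functions
  supported arbitrarily close to \<open>x\<close>. The same holds for \<open>S\<close>, and joint separation forces the two points to
  coincide; this is \<open>\<phi> y\<close>, and both functionals vanish on functions vanishing near it. Where both
  are bounded, property (P) makes them depend on \<open>f (\<phi> y)\<close> only. Uniform boundedness on \<open>E\<close>
  bounds all these functionals by one constant, so the set where some functional is
  unbounded is open. Gelfand--Mazur is proved by averaging resolvents over roots of unity, which needs
  neither completeness of the quotient nor the Hahn--Banach theorem.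
\<close>

section \<open>The Gelfand--Mazur theorem\<close>

text \<open>This is a geometric sum with ratio \<open>w ^ j\<close>, where \<open>w\<close> is the
  primitive \<open>n\<close>-th root of unity. The \<open>n\<close>-th power of the ratio is
  \<open>1\<close>, so the sum vanishes unless the ratio itself is \<open>1\<close>, that is, unless
  \<open>n\<close> divides \<open>j\<close>.\<close>

lemma root_of_unity_power_sum:
  assumes "0 < n"
  shows "(\<Sum>k<n. (cis (2 * pi / n) ^ k) ^ j) = (if n dvd j then of_nat n else 0)"
proof -
  let ?w = "cis (2 * pi / n)"
  have w: "?w ^ j = 1 \<longleftrightarrow> n dvd j"
  proof -
    have "?w ^ j = exp (2 * of_real pi * \<i> * of_nat j / of_nat n)"
      by (simp add: cis_conv_exp mult_ac flip: exp_of_nat_mult)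
    then show ?thesis
      using complex_root_unity_eq[of n j 0] assms by (simp add: mod_eq_0_iff_dvd)
  qed
  have "(?w ^ k) ^ j = (?w ^ j) ^ k" for k by (simp add: mult.commute flip: power_mult)
  moreover have "(?w ^ j) ^ n = 1"
    using assms cis_multiple_2pi[of "real j"] by (simp add: Complex.DeMoivre mult_ac flip: power_mult)
  ultimately show ?thesis
    using w geometric_sum[of "?w ^ j" n] by auto
qed

text \<open>Scalars are embedded as elements of the carrier, so scalar multiplication is ring
  multiplication and the identities below are plain ring identities.\<close>

locale complex_algebra_on =
  fixes A :: "'a::comm_ring_1 set" and \<iota> :: "complex \<Rightarrow> 'a"
  assumes emb_mem [simp, intro]: "\<iota> z \<in> A"
    and add_mem [simp, intro]: "a \<in> A \<Longrightarrow> b \<in> A \<Longrightarrow> a + b \<in> A"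
    and mult_mem [simp, intro]: "a \<in> A \<Longrightarrow> b \<in> A \<Longrightarrow> a * b \<in> A"
    and emb_one [simp]: "\<iota> 1 = 1"
    and emb_add: "\<iota> (z + w) = \<iota> z + \<iota> w"
    and emb_mult: "\<iota> (z * w) = \<iota> z * \<iota> w"
begin

section \<open>Arithmetic of the scalar embedding and closure of the carrier\<close>

lemma emb_zero [simp]: "\<iota> 0 = 0"
  using emb_add[of 0 0] by simp

lemma emb_minus: "\<iota> (- z) = - \<iota> z"
  using emb_add[of z "- z"] by (simp add: eq_neg_iff_add_eq_0 add.commute)

lemma emb_diff: "\<iota> (z - w) = \<iota> z - \<iota> w"
  using emb_add[of z "- w"] by (simp add: emb_minus)

lemma emb_power: "\<iota> (z ^ n) = \<iota> z ^ n"
  by (induction n) (simp_all add: emb_mult)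

lemma emb_sum: "\<iota> (sum f I) = (\<Sum>i\<in>I. \<iota> (f i))"
  by (induction I rule: infinite_finite_induct) (simp_all add: emb_add)

lemma one_mem [simp, intro]: "1 \<in> A"
  using emb_mem[of 1] by simp

lemma zero_mem [simp, intro]: "0 \<in> A"
  using emb_mem[of 0] by simp

lemma minus_mem [simp, intro]: "a \<in> A \<Longrightarrow> - a \<in> A"
  using mult_mem[OF emb_mem[of "- 1"], of a] by (simp add: emb_minus)

lemma diff_mem [simp, intro]: "a \<in> A \<Longrightarrow> b \<in> A \<Longrightarrow> a - b \<in> A"
  using add_mem[of a "- b"] by simp

lemma power_mem [simp, intro]: "a \<in> A \<Longrightarrow> a ^ n \<in> A"
  by (induction n) simp_all

lemma sum_mem [simp, intro]: "(\<And>i. i \<in> I \<Longrightarrow> f i \<in> A) \<Longrightarrow> sum f I \<in> A"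
  by (induction I rule: infinite_finite_induct) simp_all

end

text \<open>A seminorm, because it will later be the distance to an ideal:
  \<open>q (a - b) = 0\<close> then stands for equality in the quotient, which is never formed. The
  value \<open>q 1\<close> may exceed \<open>1\<close>.\<close>

locale seminormed_algebra_on = complex_algebra_on A \<iota>
  for A :: "'a::comm_ring_1 set" and \<iota> :: "complex \<Rightarrow> 'a" +
  fixes q :: "'a \<Rightarrow> real"
  assumes sn_nonneg [simp]: "a \<in> A \<Longrightarrow> 0 \<le> q a"
    and sn_triangle: "a \<in> A \<Longrightarrow> b \<in> A \<Longrightarrow> q (a + b) \<le> q a + q b"
    and sn_mult: "a \<in> A \<Longrightarrow> b \<in> A \<Longrightarrow> q (a * b) \<le> q a * q b"
    and sn_emb_le: "a \<in> A \<Longrightarrow> q (\<iota> z * a) \<le> norm z * q a"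
    and sn_one_pos: "0 < q 1"
begin

section \<open>Estimates and computation modulo elements of zero seminorm\<close>

lemma sn_zero [simp]: "q 0 = 0"
  using sn_emb_le[of 0 0] by (intro antisym) simp_all

text \<open>Applying \<open>sn_emb_le\<close> to the inverse scalar gives the reverse
  inequality.\<close>

lemma sn_emb:
  assumes "a \<in> A" shows "q (\<iota> z * a) = norm z * q a"
proof (cases "z = 0")
  case False
  have "q a = q (\<iota> (inverse z) * (\<iota> z * a))"
    using False by (simp flip: mult.assoc emb_mult)
  also have "\<dots> \<le> norm (inverse z) * q (\<iota> z * a)"
    using assms by (intro sn_emb_le) auto
  finally have "norm z * q a \<le> q (\<iota> z * a)"
    using False by (simp add: norm_inverse norm_divide field_simps)
  with sn_emb_le[OF assms, of z] show ?thesis by simp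
qed simp

lemma sn_minus [simp]: "a \<in> A \<Longrightarrow> q (- a) = q a"
  using sn_emb[of a "- 1"] by (simp add: emb_minus)

lemma sn_minus_commute: "a \<in> A \<Longrightarrow> b \<in> A \<Longrightarrow> q (a - b) = q (b - a)"
  using sn_minus[of "a - b"] by simp

lemma sn_diff: "a \<in> A \<Longrightarrow> b \<in> A \<Longrightarrow> q (a - b) \<le> q a + q b"
  using sn_triangle[of a "- b"] by simp

lemma sn_sum: "(\<And>i. i \<in> I \<Longrightarrow> f i \<in> A) \<Longrightarrow> q (sum f I) \<le> (\<Sum>i\<in>I. q (f i))"
proof (induction I rule: infinite_finite_induct)
  case (insert x F)
  then show ?case using sn_triangle[of "f x" "sum f F"] by fastforce
qed simp_all

lemma sn_one_ge: "1 \<le> q 1"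
  using sn_mult[of 1 1] sn_one_pos by simp

text \<open>The factor \<open>q 1\<close> accounts for \<open>n = 0\<close>, where the power is
  \<open>1\<close>.\<close>

lemma sn_power:
  assumes "a \<in> A" shows "q (a ^ n) \<le> q 1 * q a ^ n"
proof (induction n)
  case (Suc n)
  have "q (a ^ Suc n) \<le> q a * q (a ^ n)" using sn_mult[of a "a ^ n"] assms by simp
  also have "\<dots> \<le> q a * (q 1 * q a ^ n)" using Suc assms by (intro mult_left_mono) auto
  finally show ?case by (simp add: mult_ac)
qed simp

lemma sn_mult_null:
  assumes "a \<in> A" "b \<in> A" "q b = 0" shows "q (a * b) = 0"
  using sn_mult[of a b] assms by (intro antisym) auto

lemma sn_add_null:
  assumes "a \<in> A" "b \<in> A" "q b = 0" shows "q (a + b) = q a"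
  using sn_triangle[of a b] sn_triangle[of "a + b" "- b"] assms by auto

lemma sn_cong:
  assumes "a \<in> A" "b \<in> A" "q (a - b) = 0" shows "q a = q b"
  using sn_add_null[of b "a - b"] assms by auto

lemma sn_null_power:
  assumes "a \<in> A" "q (a - 1) = 0" shows "q (a ^ n - 1) = 0"
proof -
  have "a ^ n - 1 = (\<Sum>i<n. a ^ i) * (a - 1)"
    by (simp add: power_diff_1_eq mult.commute)
  then show ?thesis using assms sn_mult_null by auto
qed

text \<open>The resolvent identity \<open>r - s = (z - w) a r s\<close> holds up to multiples of the
  two inversion errors, and these have zero seminorm.\<close>

lemma resolvent_lipschitz:
  assumes "a \<in> A" "r \<in> A" "s \<in> A"
    and r: "q ((1 - \<iota> z * a) * r - 1) = 0" and s: "q ((1 - \<iota> w * a) * s - 1) = 0"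
  shows "q (r - s) \<le> norm (z - w) * (q a * q r * q s)"
proof -
  let ?e = "(1 - \<iota> z * a) * r - 1" and ?f = "(1 - \<iota> w * a) * s - 1"
  have "r - s = (\<iota> (z - w) * (a * r * s) + s * ?e) + (- r) * ?f"
    by (simp add: emb_diff algebra_simps)
  moreover have "q (\<dots>) = q (\<iota> (z - w) * (a * r * s) + s * ?e)"
    by (rule sn_add_null) (use assms in \<open>auto intro!: sn_mult_null\<close>)
  moreover have "\<dots> = q (\<iota> (z - w) * (a * r * s))"
    by (rule sn_add_null) (use assms in \<open>auto intro!: sn_mult_null\<close>)
  moreover have "\<dots> = norm (z - w) * q (a * r * s)"
    by (rule sn_emb) (use assms in auto)
  moreover have "q (a * r * s) \<le> q a * q r * q s"
    by (rule order_trans[OF sn_mult mult_right_mono[OF sn_mult]]) (use assms in auto)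
  ultimately show ?thesis by (simp add: mult_left_mono)
qed

text \<open>\<open>R\<close> is an arbitrary choice of inverses; the Lipschitz estimate bounds it
  near each point, and compactness leaves finitely many such bounds.\<close>

lemma resolvent_bounded_on_cball:
  assumes a: "a \<in> A" and R: "\<And>z. R z \<in> A" "\<And>z. q ((1 - \<iota> z * a) * R z - 1) = 0"
  shows "\<exists>C>0. \<forall>z\<in>cball 0 \<rho>. q (R z) \<le> C"
proof -
  \<comment> \<open>With this radius the Lipschitz bound for \<open>R w - R z\<close> is at most
    half of \<open>q (R w)\<close> and can be absorbed. The \<open>1\<close> keeps the denominator
    positive.\<close>
  define d where "d z = 1 / (2 * (q a * q (R z) + 1))" for z
  have dpos: "d z > 0" for z
    unfolding d_def using a R(1) by (simp add: add_nonneg_pos)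
  have loc: "q (R w) \<le> 2 * q (R z)" if "w \<in> ball z (d z)" for z w
  proof -
    have "norm (w - z) * (q a * q (R z)) \<le> d z * (q a * q (R z) + 1)"
      using that a R(1) dpos[of z]
      by (intro mult_mono) (auto simp: dist_norm norm_minus_commute intro: less_imp_le)
    also have "\<dots> = 1/2"
      using dpos[of z] by (simp add: d_def)
    finally have "norm (w - z) * (q a * q (R z)) * q (R w) \<le> 1/2 * q (R w)"
      using R(1) by (intro mult_right_mono) auto
    moreover have "q (R w - R z) \<le> norm (w - z) * (q a * q (R w) * q (R z))"
      by (rule resolvent_lipschitz) (use a R in auto)
    moreover have "q (R w) \<le> q (R w - R z) + q (R z)"
      using sn_triangle[of "R w - R z" "R z"] R(1) by simp
    ultimately show ?thesis by (simp add: mult_ac)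
  qed
  obtain D where D: "finite D" "cball 0 \<rho> \<subseteq> (\<Union>z\<in>D. ball z (d z))"
    by (rule compactE_image[OF compact_cball[of 0 \<rho>], of "cball 0 \<rho>" "\<lambda>z. ball z (d z)"])
      (use dpos in \<open>auto intro: centre_in_ball[THEN iffD2]\<close>)
  \<comment> \<open>The added \<open>1\<close> makes the bound positive even if all summands vanish
    or the cover is empty.\<close>
  have "q (R w) \<le> (\<Sum>z\<in>D. 2 * q (R z)) + 1" if w: "w \<in> cball 0 \<rho>" for w
  proof -
    obtain z where "z \<in> D" "w \<in> ball z (d z)" using D w by auto
    then have "q (R w) \<le> 2 * q (R z)" using loc by auto
    also have "\<dots> \<le> (\<Sum>z\<in>D. 2 * q (R z))"
      by (rule member_le_sum) (use D R(1) \<open>z \<in> D\<close> in auto)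
    finally show ?thesis by simp
  qed
  moreover have "(\<Sum>z\<in>D. 2 * q (R z)) + 1 > 0"
    using R(1) by (intro add_nonneg_pos sum_nonneg) auto
  ultimately show ?thesis by blast
qed

text \<open>
  The polynomial identity \<open>1 - w\<^sup>n = (1 - \<zeta> w) (\<Sum>j<n. (\<zeta> w) ^ j)\<close> for every \<open>n\<close>-th root
  of unity \<open>\<zeta>\<close> shows that averaging the resolvent over the \<open>n\<close>-th roots inverts \<open>1 - (z a)\<^sup>n\<close>.
\<close>

lemma mean_resolvent:
  assumes a: "a \<in> A" and R: "\<And>z. R z \<in> A" "\<And>z. q ((1 - \<iota> z * a) * R z - 1) = 0"
    and n: "0 < n"
  shows "q ((1 - (\<iota> z * a) ^ n) * (\<iota> (1 / of_nat n) * (\<Sum>k<n. R (cis (2 * pi / n) ^ k * z))) - 1) = 0"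
proof -
  let ?w = "cis (2 * pi / n)" and ?v = "1 - (\<iota> z * a) ^ n"
  have wn: "(?w ^ k) ^ n = 1" for k
    using n cis_multiple_2pi[of "real k"] by (simp add: Complex.DeMoivre mult_ac flip: power_mult)
  have fac: "?v = (\<Sum>j<n. (\<iota> (?w ^ k * z) * a) ^ j) * (1 - \<iota> (?w ^ k * z) * a)" for k
  proof -
    have "(\<iota> (?w ^ k * z) * a) ^ n = (\<iota> z * a) ^ n"
      using wn[of k] by (simp add: power_mult_distrib flip: emb_power)
    then show ?thesis by (metis mult.commute one_diff_power_eq)
  qed
  let ?G = "\<lambda>k. (\<Sum>j<n. (\<iota> (?w ^ k * z) * a) ^ j)"
  \<comment> \<open>Exchanging the sums isolates the sum of \<open>j\<close>-th powers over all
    \<open>n\<close>-th roots of unity; for \<open>j < n\<close> it is nonzero only at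
    \<open>j = 0\<close>. So the mean of the cofactors \<open>?G k\<close> is
    \<open>1\<close>.\<close>
  have "(\<Sum>k<n. ?G k) = (\<Sum>j<n. \<iota> (\<Sum>k<n. (?w ^ k) ^ j) * (\<iota> z * a) ^ j)"
    unfolding emb_sum sum_distrib_right
    by (subst sum.swap) (simp add: emb_mult emb_power power_mult_distrib mult_ac)
  also have "\<dots> = (\<Sum>j<n. if j = 0 then \<iota> (of_nat n) else 0)"
    by (rule sum.cong) (use n in \<open>auto simp: root_of_unity_power_sum dest: dvd_imp_le\<close>)
  also have "\<dots> = \<iota> (of_nat n)" using n by simp
  finally have G: "\<iota> (1 / of_nat n) * (\<Sum>k<n. ?G k) = 1"
    using n emb_mult[of "1 / of_nat n" "of_nat n"] by simp
  have "?v * (\<iota> (1 / of_nat n) * (\<Sum>k<n. R (?w ^ k * z))) - 1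
      = ?v * (\<iota> (1 / of_nat n) * (\<Sum>k<n. R (?w ^ k * z))) - \<iota> (1 / of_nat n) * (\<Sum>k<n. ?G k)"
    by (simp add: G)
  also have "\<dots> = \<iota> (1 / of_nat n) * (\<Sum>k<n. ?v * R (?w ^ k * z) - ?G k)"
    by (simp add: sum_distrib_left sum_subtractf right_diff_distrib mult.left_commute)
  \<comment> \<open>Each difference is the cofactor \<open>?G k\<close> times the error of the
    resolvent at the rotated point, hence has zero seminorm.\<close>
  also have "\<dots> = \<iota> (1 / of_nat n) * (\<Sum>k<n. ?G k * ((1 - \<iota> (?w ^ k * z) * a) * R (?w ^ k * z) - 1))"
  proof -
    have "?v * R (?w ^ k * z) - ?G k = ?G k * ((1 - \<iota> (?w ^ k * z) * a) * R (?w ^ k * z) - 1)" for k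
      unfolding fac[of k] by (simp only: mult.assoc right_diff_distrib[of "?G k" _ 1] mult_1_right)
    then show ?thesis by simp
  qed
  also have "q \<dots> = 0"
  proof (rule sn_mult_null)
    show "q (\<Sum>k<n. ?G k * ((1 - \<iota> (?w ^ k * z) * a) * R (?w ^ k * z) - 1)) = 0"
    proof (rule antisym)
      have "q (\<Sum>k<n. ?G k * ((1 - \<iota> (?w ^ k * z) * a) * R (?w ^ k * z) - 1))
        \<le> (\<Sum>k<n. q (?G k * ((1 - \<iota> (?w ^ k * z) * a) * R (?w ^ k * z) - 1)))"
        by (rule sn_sum) (use a R in auto)
      also have "\<dots> = 0" by (rule sum.neutral) (use a R in \<open>auto intro!: sn_mult_null\<close>)
      finally show "q (\<Sum>k<n. ?G k * ((1 - \<iota> (?w ^ k * z) * a) * R (?w ^ k * z) - 1)) \<le> 0" .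
    qed (use a R in auto)
  qed (use a R in auto)
  finally show ?thesis .
qed

text \<open>Multiplication by a root of unity preserves moduli and distances, so the mean inherits
  the constant \<open>L\<close>, independently of \<open>n\<close>.\<close>

lemma mean_resolvent_lipschitz:
  assumes R: "\<And>z. R z \<in> A"
    and L: "\<And>z w. norm z \<le> \<rho> \<Longrightarrow> norm w \<le> \<rho> \<Longrightarrow> q (R z - R w) \<le> L * norm (z - w)"
    and n: "0 < n" and zw: "norm z \<le> \<rho>" "norm w \<le> \<rho>"
  shows "q (\<iota> (1 / of_nat n) * (\<Sum>k<n. R (cis (2 * pi / n) ^ k * z))
      - \<iota> (1 / of_nat n) * (\<Sum>k<n. R (cis (2 * pi / n) ^ k * w))) \<le> L * norm (z - w)"
proof -
  let ?w = "cis (2 * pi / n)"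
  have "q (\<Sum>k<n. R (?w ^ k * z) - R (?w ^ k * w)) \<le> (\<Sum>k<n. q (R (?w ^ k * z) - R (?w ^ k * w)))"
    by (rule sn_sum) (use R in auto)
  also have "\<dots> \<le> (\<Sum>k<n. L * norm (z - w))"
  proof (rule sum_mono)
    fix k
    have "norm (?w ^ k * z - ?w ^ k * w) = norm (z - w)"
      by (simp add: norm_mult norm_power flip: right_diff_distrib)
    then show "q (R (?w ^ k * z) - R (?w ^ k * w)) \<le> L * norm (z - w)"
      using L[of "?w ^ k * z" "?w ^ k * w"] zw by (simp add: norm_mult norm_power)
  qed
  finally have "q (\<Sum>k<n. R (?w ^ k * z) - R (?w ^ k * w)) \<le> n * (L * norm (z - w))" by simp
  then have "q (\<iota> (1 / of_nat n) * (\<Sum>k<n. R (?w ^ k * z) - R (?w ^ k * w))) \<le> L * norm (z - w)"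
    using R n by (subst sn_emb) (auto simp: norm_divide field_simps)
  then show ?thesis by (simp add: sum_subtractf right_diff_distrib)
qed


text \<open>
  If the scales \<open>s\<close> with bounded \<open>s\<^sup>n q(a\<^sup>n)\<close> had a finite supremum \<open>s0\<close>, then for large \<open>n\<close> the means at
  some \<open>s1 < s0\<close> would be close to \<open>1\<close>, hence, by the Lipschitz bound uniform in \<open>n\<close>, so would the
  means at some \<open>s2 > s0\<close>; but then \<open>1 - (s2 a)\<^sup>n\<close> is bounded.
\<close>

lemma resolvent_everywhere_imp_quasinilpotent:
  assumes a: "a \<in> A" and R: "\<And>z. R z \<in> A" "\<And>z. q ((1 - \<iota> z * a) * R z - 1) = 0"
  shows "\<exists>s>b. \<exists>K. \<forall>\<^sub>F n in sequentially. s ^ n * q (a ^ n) \<le> K"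
proof (rule ccontr)
  assume neg: "\<not> ?thesis"
  define B where "B = {s. 0 \<le> s \<and> (\<exists>K. \<forall>\<^sub>F n in sequentially. s ^ n * q (a ^ n) \<le> K)}"
  have sn_scaled: "q ((\<iota> (complex_of_real s) * a) ^ n) = s ^ n * q (a ^ n)" if "0 \<le> s" for s n
    using sn_emb[of "a ^ n" "complex_of_real s ^ n"] a that
    by (simp add: power_mult_distrib norm_power flip: emb_power)
  have "0 \<in> B"
    unfolding B_def by (auto intro!: exI[of _ 0] eventually_sequentiallyI[of 1] simp: zero_power)
  have bdd: "bdd_above B"
    using neg by (auto simp: B_def bdd_above_def not_less intro!: exI[of _ b])
  define s0 where "s0 = Sup B"
  have s0: "0 \<le> s0" "s \<in> B \<Longrightarrow> s \<le> s0" for s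
    unfolding s0_def using \<open>0 \<in> B\<close> bdd by (auto intro: cSup_upper)
  obtain C where C: "C > 0" "\<forall>z\<in>cball 0 (s0 + 1). q (R z) \<le> C"
    using resolvent_bounded_on_cball[OF a R] by blast
  define L where "L = q a * C * C"
  have L: "0 \<le> L" unfolding L_def using a C by simp
  have lip: "q (R z - R w) \<le> L * norm (z - w)" if "norm z \<le> s0 + 1" "norm w \<le> s0 + 1" for z w
  proof -
    have "q (R z - R w) \<le> norm (z - w) * (q a * q (R z) * q (R w))"
      by (rule resolvent_lipschitz[OF a R(1) R(1) R(2) R(2)])
    also have "\<dots> \<le> norm (z - w) * (q a * C * C)"
      using that C a R(1) by (intro mult_left_mono mult_mono) auto
    finally show ?thesis by (simp add: L_def mult_ac)
  qed
  \<comment> \<open>The bound \<open>1\<close> keeps \<open>s0 + d\<close> inside the disc on which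
    \<open>L\<close> is valid; the other bound lets the means move by at most \<open>1 / 4\<close>
    over a distance of \<open>2 * d\<close>.\<close>
  define d where "d = min 1 (1 / (8 * (L + 1)))"
  have d: "0 < d" "d \<le> 1" "L * (2 * d) \<le> 1 / 4"
  proof -
    have "L * (2 * d) \<le> L * (2 * (1 / (8 * (L + 1))))"
      unfolding d_def using L by (intro mult_left_mono) auto
    also have "\<dots> \<le> 1 / 4" using L by (simp add: field_simps)
    finally show "L * (2 * d) \<le> 1 / 4" .
  qed (use L in \<open>auto simp: d_def\<close>)
  obtain s where s: "s \<in> B" "s0 - d / 2 < s"
    using less_cSupD[of B "s0 - d / 2"] \<open>0 \<in> B\<close> d by (auto simp: s0_def)
  \<comment> \<open>A positive \<open>s1\<close> lies strictly below the member \<open>s\<close> of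
    \<open>B\<close>, so \<open>s1 ^ n * q (a ^ n)\<close> decays geometrically; for
    \<open>s1 = 0\<close> it vanishes once \<open>n \<ge> 1\<close>.\<close>
  define s1 where "s1 = max 0 (s - d / 2)"
  define s2 where "s2 = s0 + d"
  have s12: "0 \<le> s1" "s1 \<le> s0 + 1" "0 \<le> s2" "s2 \<le> s0 + 1" "\<bar>s2 - s1\<bar> \<le> 2 * d"
    using s s0(1) s0(2)[OF s(1)] d unfolding s1_def s2_def by (auto simp: max_def)
  have lim: "(\<lambda>n. s1 ^ n * q (a ^ n)) \<longlonglongrightarrow> 0"
  proof (cases "s1 = 0")
    case True
    then show ?thesis
      by (intro tendsto_eventually eventually_sequentiallyI[of 1]) (auto simp: zero_power)
  next
    case False
    then have s1s: "0 < s1" "s1 < s" using d by (auto simp: s1_def max_def split: if_splits)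
    obtain K where K: "\<forall>\<^sub>F n in sequentially. s ^ n * q (a ^ n) \<le> K"
      using s by (auto simp: B_def)
    have "\<forall>\<^sub>F n in sequentially. norm (s1 ^ n * q (a ^ n)) \<le> (s1 / s) ^ n * K"
      using K
    proof eventually_elim
      case (elim n)
      have "s1 ^ n * q (a ^ n) = (s1 / s) ^ n * (s ^ n * q (a ^ n))"
        using s1s by (simp add: power_divide)
      also have "\<dots> \<le> (s1 / s) ^ n * K" using elim s1s by (intro mult_left_mono) auto
      finally show ?case using s1s a by simp
    qed
    moreover have "(\<lambda>n. (s1 / s) ^ n * K) \<longlonglongrightarrow> 0 * K"
      using s1s by (intro tendsto_mult_right LIMSEQ_realpow_zero) auto
    ultimately show ?thesis by (auto intro: Lim_null_comparison[rotated])
  qed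
  \<comment> \<open>Since \<open>?f\<close> equals \<open>1 + ?w * ?f\<close> up to zero seminorm,
    this threshold gives \<open>q (?f - 1) \<le> q (?f - 1) / 5 + 1 / 5\<close> below, and hence the
    bound \<open>1 / 4\<close>.\<close>
  have "\<forall>\<^sub>F n in sequentially. s1 ^ n * q (a ^ n) < 1 / (5 * q 1)"
    using sn_one_ge by (intro order_tendstoD[OF lim]) auto
  then have "\<forall>\<^sub>F n in sequentially. s2 ^ n * q (a ^ n) \<le> 3 * q 1"
    using eventually_gt_at_top[of 0]
  proof eventually_elim
    case (elim n)
    define F where "F z = \<iota> (1 / of_nat n) * (\<Sum>k<n. R (cis (2 * pi / n) ^ k * z))" for z
    have F: "F z \<in> A" "q ((1 - (\<iota> z * a) ^ n) * F z - 1) = 0" for z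
      unfolding F_def using R elim by (auto intro!: mean_resolvent[OF a R])
    let ?f = "F (complex_of_real s1)" and ?g = "F (complex_of_real s2)"
    let ?w = "(\<iota> (complex_of_real s1) * a) ^ n" and ?v = "(\<iota> (complex_of_real s2) * a) ^ n"
    have f1: "q (?f - 1) \<le> 1 / 4"
    proof -
      have "q (?f - 1 - ?w * ?f) = 0" using F(2)[of s1] by (simp add: algebra_simps)
      then have "q (?f - 1) = q (?w * ?f)" using F a by (intro sn_cong) auto
      also have "\<dots> \<le> q ?w * q ?f" using F a by (intro sn_mult) auto
      also have "\<dots> \<le> 1 / (5 * q 1) * (q (?f - 1) + q 1)"
        using F(1) elim s12 a sn_triangle[of "?f - 1" 1] sn_one_pos
        by (intro mult_mono) (auto simp: sn_scaled)
      also have "\<dots> = q (?f - 1) / (5 * q 1) + 1 / 5" using sn_one_pos by (simp add: field_simps)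
      also have "q (?f - 1) / (5 * q 1) \<le> q (?f - 1) / 5"
        using sn_one_ge F(1) by (intro divide_left_mono) auto
      finally show ?thesis by simp
    qed
    have "q (?g - ?f) \<le> L * norm (complex_of_real s2 - complex_of_real s1)"
      unfolding F_def using elim s12 by (intro mean_resolvent_lipschitz[OF R(1) lip]) auto
    also have "\<dots> \<le> L * (2 * d)"
      using L s12 by (intro mult_left_mono) (auto simp flip: of_real_diff)
    finally have "q (?g - ?f) \<le> 1 / 4" using d by simp
    then have g1: "q (?g - 1) \<le> 1 / 2"
      using sn_triangle[of "?g - ?f" "?f - 1"] f1 F(1) by simp
    \<comment> \<open>Since \<open>?g\<close> inverts \<open>1 - ?v\<close> up to zero seminorm,
      \<open>1 - ?v\<close> can be written in terms of itself times \<open>?g - 1\<close>. As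
      \<open>q (?g - 1) \<le> 1 / 2\<close>, half of \<open>q (1 - ?v)\<close> is absorbed on the
      left.\<close>
    have "q ((1 - ?v) - (1 - (1 - ?v) * (?g - 1))) = 0"
      using F(2)[of s2] by (simp add: algebra_simps)
    then have "q (1 - ?v) = q (1 - (1 - ?v) * (?g - 1))" using F a by (intro sn_cong) auto
    also have "\<dots> \<le> q 1 + q ((1 - ?v) * (?g - 1))" using F a by (intro sn_diff) auto
    also have "q ((1 - ?v) * (?g - 1)) \<le> q (1 - ?v) * q (?g - 1)"
      using F a by (intro sn_mult) auto
    also have "\<dots> \<le> q (1 - ?v) * (1 / 2)" using g1 a by (intro mult_left_mono) auto
    finally have "q (1 - ?v) \<le> 2 * q 1" by simp
    then have "q ?v \<le> 3 * q 1" using sn_diff[of 1 "1 - ?v"] a by simp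
    then show ?case using s12 by (simp add: sn_scaled)
  qed
  then have "s2 \<in> B" using s12 by (auto simp: B_def)
  then show False using s0(2)[of s2] d by (simp add: s2_def)
qed

text \<open>If every \<open>a - \<iota> z\<close> were invertible up to zero seminorm, so would be
  every \<open>1 - \<iota> z * a\<close>. Then the powers of \<open>a\<close> decay at a rate
  beating the growth of the powers of its inverse \<open>b\<close>, although
  \<open>a ^ n * b ^ n\<close> is \<open>1\<close> up to zero seminorm.\<close>

theorem gelfand_mazur:
  assumes a: "a \<in> A"
  shows "\<exists>z. \<forall>b\<in>A. q ((a - \<iota> z) * b - 1) \<noteq> 0"
proof (rule ccontr)
  assume "\<not> ?thesis"
  then obtain r where r: "\<And>z. r z \<in> A" "\<And>z. q ((a - \<iota> z) * r z - 1) = 0" by metis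
  \<comment> \<open>For nonzero \<open>z\<close> this uses \<open>1 - z a = - z (a - 1 / z)\<close>;
    at \<open>z = 0\<close> the element to invert is \<open>1\<close>.\<close>
  define R where "R z = (if z = 0 then 1 else \<iota> (- 1 / z) * r (1 / z))" for z
  have RA: "R z \<in> A" for z using r by (auto simp: R_def)
  have "(1 - \<iota> z * a) * R z - 1 = (a - \<iota> (1 / z)) * r (1 / z) - 1" if "z \<noteq> 0" for z
  proof -
    have "\<iota> (1 / z) * \<iota> z = 1" using that by (simp flip: emb_mult)
    then have "(1 - \<iota> z * a) * - \<iota> (1 / z) = a - \<iota> (1 / z)"
      by (simp add: algebra_simps)
    moreover have "R z = - \<iota> (1 / z) * r (1 / z)" using that by (simp add: R_def emb_minus)
    ultimately show ?thesis by (metis mult.assoc)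
  qed
  then have R: "q ((1 - \<iota> z * a) * R z - 1) = 0" for z
    using r(2)[of "1 / z"] by (cases "z = 0") (auto simp: R_def)
  define b where "b = r 0"
  have b: "b \<in> A" "q (a * b - 1) = 0" using r[of 0] by (auto simp: b_def)
  obtain s K where s: "q b < s" and K: "\<forall>\<^sub>F n in sequentially. s ^ n * q (a ^ n) \<le> K"
    using resolvent_everywhere_imp_quasinilpotent[OF a RA R] by blast
  have s0: "0 < s" using s b sn_nonneg[of b] by linarith
  have "\<forall>\<^sub>F n in sequentially. q 1 \<le> K * q 1 * (q b / s) ^ n"
    using K
  proof eventually_elim
    case (elim n)
    have "q ((a * b) ^ n - 1) = 0" using a b by (intro sn_null_power) auto
    then have "q 1 = q (a ^ n * b ^ n)"
      using a b sn_cong[of "(a * b) ^ n" 1] by (simp add: power_mult_distrib)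
    also have "\<dots> \<le> q (a ^ n) * q (b ^ n)" using a b by (intro sn_mult) auto
    also have "\<dots> \<le> (K / s ^ n) * (q 1 * q b ^ n)"
      using a b elim s0 by (intro mult_mono sn_power) (auto simp: field_simps intro: order_trans[rotated])
    finally show ?case by (simp add: power_divide mult_ac)
  qed
  moreover have "(\<lambda>n. K * q 1 * (q b / s) ^ n) \<longlonglongrightarrow> K * q 1 * 0"
    using s s0 b by (intro tendsto_mult_left LIMSEQ_realpow_zero) auto
  ultimately have "q 1 \<le> K * q 1 * 0"
    by (intro tendsto_lowerbound[where f = "\<lambda>n. K * q 1 * (q b / s) ^ n" and F = sequentially]) auto
  with sn_one_pos show False by simp
qed

end

section \<open>Ideals and characters of commutative Banach algebras\<close>

text \<open>The norm is abstract: a Banach function algebra is complete under some norm, which may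
  differ from the supremum norm.\<close>

locale banach_algebra_on = complex_algebra_on A \<iota>
  for A :: "'a::comm_ring_1 set" and \<iota> :: "complex \<Rightarrow> 'a" +
  fixes N :: "'a \<Rightarrow> real"
  assumes nm_nonneg [simp]: "a \<in> A \<Longrightarrow> 0 \<le> N a"
    and nm_eq_zero: "a \<in> A \<Longrightarrow> N a = 0 \<longleftrightarrow> a = 0"
    and nm_triangle: "a \<in> A \<Longrightarrow> b \<in> A \<Longrightarrow> N (a + b) \<le> N a + N b"
    and nm_mult: "a \<in> A \<Longrightarrow> b \<in> A \<Longrightarrow> N (a * b) \<le> N a * N b"
    and nm_emb: "a \<in> A \<Longrightarrow> N (\<iota> z * a) = norm z * N a"
    and nm_complete: "(\<And>n. F n \<in> A) \<Longrightarrow> \<forall>e>0. \<exists>n0. \<forall>m\<ge>n0. \<forall>n\<ge>n0. N (F m - F n) < e \<Longrightarrow>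
      \<exists>f\<in>A. (\<lambda>n::nat. N (F n - f)) \<longlonglongrightarrow> 0"
begin

sublocale seminormed_algebra_on A \<iota> N
proof
  have "N 1 \<noteq> 0" using nm_eq_zero[of 1] by simp
  then show "0 < N 1" using nm_nonneg[of 1] by (simp add: less_le)
qed (simp_all add: nm_triangle nm_mult nm_emb)

text \<open>The partial sums of the geometric series are Cauchy by comparison with
  \<open>N 1 * N a ^ i\<close>, and their limit is the inverse.\<close>

lemma neumann:
  assumes a: "a \<in> A" "N a < 1"
  shows "\<exists>b\<in>A. (1 - a) * b = 1"
proof -
  define P where "P n = (\<Sum>i<n. a ^ i)" for n
  have P: "P n \<in> A" "(1 - a) * P n = 1 - a ^ n" for n
    unfolding P_def using a by (auto simp: one_diff_power_eq)
  have "\<exists>n0. \<forall>m\<ge>n0. \<forall>n\<ge>n0. N (P m - P n) < e" if e: "e > 0" for e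
  proof -
    have "Cauchy (\<lambda>n. \<Sum>i<n. N 1 * N a ^ i)"
      using a by (intro summable_LIMSEQ[THEN LIMSEQ_imp_Cauchy] summable_mult summable_geometric) auto
    then obtain n0 where
      n0: "\<And>m n. m \<ge> n0 \<Longrightarrow> n \<ge> n0 \<Longrightarrow> \<bar>(\<Sum>i<m. N 1 * N a ^ i) - (\<Sum>i<n. N 1 * N a ^ i)\<bar> < e"
      using e unfolding Cauchy_def dist_real_def by blast
    have le: "N (P m - P n) < e" if "m \<ge> n" "n \<ge> n0" for m n
    proof -
      have "P m - P n = (\<Sum>i\<in>{n..<m}. a ^ i)"
        using that unfolding P_def by (simp add: lessThan_atLeast0 sum_diff_nat_ivl)
      also have "N \<dots> \<le> (\<Sum>i\<in>{n..<m}. N (a ^ i))" using a by (intro sn_sum) auto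
      also have "\<dots> \<le> (\<Sum>i\<in>{n..<m}. N 1 * N a ^ i)" using a by (intro sum_mono sn_power) auto
      also have "\<dots> = (\<Sum>i<m. N 1 * N a ^ i) - (\<Sum>i<n. N 1 * N a ^ i)"
        using that by (simp add: lessThan_atLeast0 sum_diff_nat_ivl)
      also have "\<dots> < e" using n0[of m n] that by simp
      finally show ?thesis .
    qed
    have "N (P m - P n) < e" if "m \<ge> n0" "n \<ge> n0" for m n
      using le[of m n] le[of n m] that sn_minus_commute[of "P m" "P n"] P(1)
      by (cases "m \<ge> n") auto
    then show ?thesis by blast
  qed
  then obtain b where b: "b \<in> A" "(\<lambda>n. N (P n - b)) \<longlonglongrightarrow> 0"
    using nm_complete[of P] P(1) by blast
  \<comment> \<open>\<open>P n\<close> inverts \<open>1 - a\<close> up to \<open>a ^ n\<close>, so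
    replacing \<open>b\<close> by \<open>P n\<close> costs only terms that tend to
    \<open>0\<close>.\<close>
  have "N ((1 - a) * b - 1) \<le> N (1 - a) * N (P n - b) + N 1 * N a ^ n" for n
  proof -
    have "(1 - a) * b - 1 = - ((1 - a) * (P n - b) + a ^ n)"
      using P(2)[of n] by (simp add: algebra_simps)
    then have "N ((1 - a) * b - 1) = N ((1 - a) * (P n - b) + a ^ n)"
      using sn_minus[of "(1 - a) * (P n - b) + a ^ n"] a b P(1) by simp
    also have "\<dots> \<le> N ((1 - a) * (P n - b)) + N (a ^ n)" using a b P(1) by (intro nm_triangle) auto
    also have "\<dots> \<le> N (1 - a) * N (P n - b) + N 1 * N a ^ n"
      using a b P(1) by (intro add_mono nm_mult sn_power) auto
    finally show ?thesis .
  qed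
  then have le: "\<exists>n0. \<forall>n\<ge>n0. N ((1 - a) * b - 1) \<le> N (1 - a) * N (P n - b) + N 1 * N a ^ n"
    by blast
  have "(\<lambda>n. N (1 - a) * N (P n - b) + N 1 * N a ^ n) \<longlonglongrightarrow> N (1 - a) * 0 + N 1 * 0"
    using a b by (intro tendsto_intros LIMSEQ_realpow_zero) auto
  from LIMSEQ_le_const[OF this le] have "N ((1 - a) * b - 1) \<le> N (1 - a) * 0 + N 1 * 0" .
  then have "N ((1 - a) * b - 1) = 0" using a b by (intro antisym) auto
  then show ?thesis using a b nm_eq_zero[of "(1 - a) * b - 1"] by auto
qed

section \<open>Proper ideals, maximal ideals and the quotient seminorm\<close>

definition ideal_on :: "'a set \<Rightarrow> bool"
  where "ideal_on J \<longleftrightarrow> J \<subseteq> A \<and> 0 \<in> J \<and> (\<forall>x\<in>J. \<forall>y\<in>J. x + y \<in> J) \<and> (\<forall>a\<in>A. \<forall>x\<in>J. a * x \<in> J)"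

lemma ideal_onD:
  assumes "ideal_on J"
  shows "x \<in> J \<Longrightarrow> x \<in> A" "0 \<in> J" "x \<in> J \<Longrightarrow> y \<in> J \<Longrightarrow> x + y \<in> J" "a \<in> A \<Longrightarrow> x \<in> J \<Longrightarrow> a * x \<in> J"
    "x \<in> J \<Longrightarrow> y \<in> J \<Longrightarrow> x - y \<in> J"
proof -
  show *: "x \<in> J \<Longrightarrow> x \<in> A" "0 \<in> J" "x \<in> J \<Longrightarrow> y \<in> J \<Longrightarrow> x + y \<in> J" "a \<in> A \<Longrightarrow> x \<in> J \<Longrightarrow> a * x \<in> J" for a x y
    using assms by (auto simp: ideal_on_def)
  show "x \<in> J \<Longrightarrow> y \<in> J \<Longrightarrow> x - y \<in> J"
    using *(3)[of x "- 1 * y"] *(4)[of "- 1" y] by simp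
qed

text \<open>An element at distance less than \<open>1\<close> from \<open>1\<close> is invertible by
  the Neumann series and would put \<open>1\<close> into the ideal. This will keep the quotient
  seminorm of \<open>1\<close> positive.\<close>

lemma proper_ideal_far_from_one:
  assumes J: "ideal_on J" "1 \<notin> J" and x: "x \<in> J"
  shows "1 \<le> N (1 - x)"
proof (rule ccontr)
  assume "\<not> ?thesis"
  then obtain b where "b \<in> A" "x * b = 1"
    using neumann[of "1 - x"] ideal_onD(1)[OF J(1) x] by auto
  then show False using ideal_onD(4)[OF J(1), of b x] J(2) x by (simp add: mult.commute)
qed

text \<open>By Zorn's lemma: the union of a chain of ideals is an ideal, and it omits
  \<open>1\<close> if every member does.\<close>

lemma maximal_ideal_exists:
  assumes "ideal_on J" "1 \<notin> J"
  shows "\<exists>I. ideal_on I \<and> 1 \<notin> I \<and> J \<subseteq> I \<and> (\<forall>K. ideal_on K \<longrightarrow> 1 \<notin> K \<longrightarrow> I \<subseteq> K \<longrightarrow> K = I)"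
proof -
  let ?\<A> = "{I. ideal_on I \<and> 1 \<notin> I \<and> J \<subseteq> I}"
  have "\<exists>M\<in>?\<A>. \<forall>X\<in>?\<A>. M \<subseteq> X \<longrightarrow> X = M"
  proof (rule subset_Zorn_nonempty)
    fix \<C> assume \<C>: "\<C> \<noteq> {}" "subset.chain ?\<A> \<C>"
    then have sub: "\<C> \<subseteq> ?\<A>" and ch: "\<And>X Y. X \<in> \<C> \<Longrightarrow> Y \<in> \<C> \<Longrightarrow> X \<subseteq> Y \<or> Y \<subseteq> X"
      by (auto simp: subset_chain_def)
    have idl: "ideal_on X" if "X \<in> \<C>" for X using sub that by auto
    have "x + y \<in> \<Union>\<C>" if xy: "x \<in> \<Union>\<C>" "y \<in> \<Union>\<C>" for x y
    proof -
      obtain X Y where XY: "X \<in> \<C>" "Y \<in> \<C>" "x \<in> X" "y \<in> Y" using xy by blast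
      with ch[of X Y] have "x \<in> Y \<or> y \<in> X" by blast
      then show ?thesis using XY ideal_onD(3)[OF idl] by blast
    qed
    moreover have "0 \<in> \<Union>\<C>" using \<C>(1) ideal_onD(2)[OF idl] by blast
    moreover have "\<Union>\<C> \<subseteq> A" using ideal_onD(1)[OF idl] by blast
    moreover have "\<forall>a\<in>A. \<forall>x\<in>\<Union>\<C>. a * x \<in> \<Union>\<C>" using ideal_onD(4)[OF idl] by blast
    ultimately have "ideal_on (\<Union>\<C>)" unfolding ideal_on_def by blast
    moreover have "1 \<notin> \<Union>\<C>" "J \<subseteq> \<Union>\<C>" using sub \<C>(1) by auto
    ultimately show "\<Union>\<C> \<in> ?\<A>" by simp
  qed (use assms in blast)
  then obtain I where "I \<in> ?\<A>" "\<forall>X\<in>?\<A>. I \<subseteq> X \<longrightarrow> X = I" ..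
  then show ?thesis by (intro exI[of _ I]) auto
qed

text \<open>The seminorm is the distance to \<open>J\<close>; each inequality is checked on almost
  nearest elements of \<open>J\<close>.\<close>

lemma quotient_seminorm:
  assumes J: "ideal_on J" "1 \<notin> J"
  shows "\<exists>q. seminormed_algebra_on A \<iota> q \<and> (\<forall>x\<in>J. q x = 0)"
proof (intro exI conjI ballI)
  define q where "q a = (INF x\<in>J. N (a - x))" for a
  note JA = ideal_onD(1)[OF J(1)]
  have ne: "J \<noteq> {}" using ideal_onD(2)[OF J(1)] by blast
  have bdd: "bdd_below ((\<lambda>x. N (a - x)) ` J)" if "a \<in> A" for a
    using that JA by (intro bdd_belowI2[of _ 0]) auto
  have q_le: "q a \<le> N (a - x)" if "a \<in> A" "x \<in> J" for a x
    unfolding q_def using that bdd by (intro cINF_lower) auto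
  have q_ge: "c \<le> q a" if "\<And>x. x \<in> J \<Longrightarrow> c \<le> N (a - x)" for a c
    unfolding q_def using that ne by (intro cINF_greatest) auto
  have q_nonneg: "0 \<le> q a" if "a \<in> A" for a
    using that JA by (intro q_ge) auto
  have approx: "\<exists>x\<in>J. N (a - x) < q a + e" if "a \<in> A" "e > 0" for a e
    using cINF_less_iff[OF ne bdd[OF that(1)], of "q a + e"] that by (simp add: q_def)
  show "seminormed_algebra_on A \<iota> q"
  proof
    show "0 < q 1"
      using q_ge[of 1 1] proper_ideal_far_from_one[OF J] by fastforce
    fix a assume a: "a \<in> A"
    show "0 \<le> q a" by (rule q_nonneg[OF a])
    show "q (\<iota> z * a) \<le> norm z * q a" for z
    proof (rule field_le_epsilon)
      fix e :: real assume e: "e > 0"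
      \<comment> \<open>Dividing by \<open>norm z + 1\<close> instead of \<open>norm z\<close> also
        covers \<open>z = 0\<close>.\<close>
      obtain x where x: "x \<in> J" "N (a - x) < q a + e / (norm z + 1)"
        using approx[OF a, of "e / (norm z + 1)"] e by (auto simp: add_nonneg_pos)
      have "q (\<iota> z * a) \<le> N (\<iota> z * a - \<iota> z * x)"
        using a x ideal_onD(4)[OF J(1)] by (intro q_le) auto
      also have "\<dots> = norm z * N (a - x)"
        using a x JA by (simp add: nm_emb flip: right_diff_distrib)
      also have "\<dots> \<le> norm z * (q a + e / (norm z + 1))"
        using x by (intro mult_left_mono) auto
      also have "\<dots> \<le> norm z * q a + e"
      proof -
        have "norm z * (e / (norm z + 1)) \<le> (norm z + 1) * (e / (norm z + 1))"
          using e by (intro mult_right_mono) auto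
        also have "\<dots> = e"
          using norm_ge_zero[of z] by (simp add: add_nonneg_eq_0_iff)
        finally show ?thesis by (simp add: distrib_left)
      qed
      finally show "q (\<iota> z * a) \<le> norm z * q a + e" .
    qed
    fix b assume b: "b \<in> A"
    show "q (a + b) \<le> q a + q b"
    proof (rule field_le_epsilon)
      fix e :: real assume e: "e > 0"
      obtain x y where x: "x \<in> J" "N (a - x) < q a + e / 2" and y: "y \<in> J" "N (b - y) < q b + e / 2"
        using approx[OF a, of "e / 2"] approx[OF b, of "e / 2"] e by auto
      have "q (a + b) \<le> N (a + b - (x + y))"
        using a b x y ideal_onD(3)[OF J(1)] by (intro q_le) auto
      also have "\<dots> = N ((a - x) + (b - y))" by (simp add: algebra_simps)
      also have "\<dots> \<le> N (a - x) + N (b - y)" using a b x y JA by (intro nm_triangle) auto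
      finally show "q (a + b) \<le> q a + q b + e" using x y by linarith
    qed
    have ab: "q (a * b) \<le> (q a + e) * (q b + e)" if e: "e > 0" for e
    proof -
      obtain x y where x: "x \<in> J" "N (a - x) < q a + e" and y: "y \<in> J" "N (b - y) < q b + e"
        using approx[OF a e] approx[OF b e] by auto
      \<comment> \<open>This element of \<open>J\<close> is chosen so that subtracting it from
        \<open>a * b\<close> leaves \<open>(a - x) * (b - y)\<close>.\<close>
      have "b * x + (a - x) * y \<in> J"
        using a b x y JA ideal_onD(3,4)[OF J(1)] by auto
      then have "q (a * b) \<le> N (a * b - (b * x + (a - x) * y))"
        using a b by (intro q_le) auto
      also have "\<dots> = N ((a - x) * (b - y))" by (simp add: algebra_simps)
      also have "\<dots> \<le> N (a - x) * N (b - y)" using a b x y JA by (intro nm_mult) auto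
      also have "\<dots> \<le> (q a + e) * (q b + e)"
        using a b x y JA e q_nonneg[OF a] by (intro mult_mono) auto
      finally show ?thesis .
    qed
    have "((\<lambda>e. (q a + e) * (q b + e)) \<longlongrightarrow> (q a + 0) * (q b + 0)) (at_right 0)"
      by (intro tendsto_intros)
    then have "q (a * b) \<le> (q a + 0) * (q b + 0)"
      by (rule tendsto_lowerbound) (auto simp: ab eventually_at_filter)
    then show "q (a * b) \<le> q a * q b" by simp
  qed
  show "q x = 0" if "x \<in> J" for x
    using q_le[of x x] q_nonneg[of x] that JA by (intro antisym) auto
qed

text \<open>Modulo a maximal ideal \<open>I\<close> containing \<open>J\<close> every element is a
  scalar: Gelfand--Mazur provides \<open>z\<close> with \<open>a - \<iota> z\<close> not invertible,
  so \<open>I\<close> and \<open>a - \<iota> z\<close> generate a proper ideal, which by maximality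
  is \<open>I\<close>. The character maps \<open>a\<close> to this scalar.\<close>

theorem character_on_proper_ideal:
  assumes J: "ideal_on J" "1 \<notin> J"
  shows "\<exists>\<omega>. (\<forall>a\<in>A. \<forall>b\<in>A. \<omega> (a + b) = \<omega> a + \<omega> b) \<and> (\<forall>a\<in>A. \<forall>b\<in>A. \<omega> (a * b) = \<omega> a * \<omega> b) \<and>
    (\<forall>z. \<omega> (\<iota> z) = z) \<and> (\<forall>x\<in>J. \<omega> x = 0)"
proof -
  obtain I where I: "ideal_on I" "1 \<notin> I" "J \<subseteq> I"
    and max: "\<And>K. ideal_on K \<Longrightarrow> 1 \<notin> K \<Longrightarrow> I \<subseteq> K \<Longrightarrow> K = I"
    using maximal_ideal_exists[OF J] by metis
  note idl = ideal_onD[OF I(1)]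
  obtain q where q: "seminormed_algebra_on A \<iota> q" "\<And>x. x \<in> I \<Longrightarrow> q x = 0"
    using quotient_seminorm[OF I(1,2)] by blast
  have ex: "\<exists>z. a - \<iota> z \<in> I" if a: "a \<in> A" for a
  proof (rule ccontr)
    assume neg: "\<not> ?thesis"
    obtain z where z: "\<And>b. b \<in> A \<Longrightarrow> q ((a - \<iota> z) * b - 1) \<noteq> 0"
      using seminormed_algebra_on.gelfand_mazur[OF q(1) a] by blast
    define K where "K = {x + b * (a - \<iota> z) |x b. x \<in> I \<and> b \<in> A}"
    have KI: "x + b * (a - \<iota> z) \<in> K" if "x \<in> I" "b \<in> A" for x b using that by (auto simp: K_def)
    have "ideal_on K"
      unfolding ideal_on_def
    proof (intro conjI ballI)
      show "K \<subseteq> A" using a idl(1) by (auto simp: K_def)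
      show "0 \<in> K" using KI[of 0 0] idl(2) by simp
      fix k l assume "k \<in> K" "l \<in> K"
      then obtain x b y c where kl: "x \<in> I" "b \<in> A" "k = x + b * (a - \<iota> z)"
        "y \<in> I" "c \<in> A" "l = y + c * (a - \<iota> z)" unfolding K_def by blast
      have "k + l = (x + y) + (b + c) * (a - \<iota> z)" by (simp add: kl algebra_simps)
      then show "k + l \<in> K" using KI[of "x + y" "b + c"] idl(3) kl(1,2,4,5) by simp
    next
      fix c k assume "c \<in> A" "k \<in> K"
      then obtain x b where k: "x \<in> I" "b \<in> A" "k = x + b * (a - \<iota> z)" unfolding K_def by blast
      have "c * k = c * x + (c * b) * (a - \<iota> z)" by (simp add: k algebra_simps)
      then show "c * k \<in> K" using KI[of "c * x" "c * b"] idl(4) \<open>c \<in> A\<close> k(1,2) by simp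
    qed
    moreover have "I \<subseteq> K" using KI[of _ 0] by auto
    moreover have "a - \<iota> z \<in> K" using KI[of 0 1] idl(2) by simp
    ultimately have "1 \<in> K" using max neg by blast
    then obtain x b where xb: "x \<in> I" "b \<in> A" "1 = x + b * (a - \<iota> z)" unfolding K_def by blast
    \<comment> \<open>Membership of \<open>1\<close> in \<open>K\<close> makes \<open>b\<close> an
      inverse of \<open>a - \<iota> z\<close> up to an element of \<open>I\<close>, where
      \<open>q\<close> vanishes, against the choice of \<open>z\<close>.\<close>
    then have "(a - \<iota> z) * b - 1 = - 1 * x" by (simp add: algebra_simps)
    then show False using z[OF xb(2)] q(2)[of "- 1 * x"] idl(4)[of "- 1" x] xb by simp
  qed
  then obtain \<omega> where \<omega>: "\<And>a. a \<in> A \<Longrightarrow> a - \<iota> (\<omega> a) \<in> I" by metis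
  \<comment> \<open>Two different scalars would put a nonzero, hence invertible, scalar into
    \<open>I\<close>. Additivity and multiplicativity follow by exhibiting members of
    \<open>I\<close>.\<close>
  have uniq: "\<omega> a = z" if "a \<in> A" "a - \<iota> z \<in> I" for a z
  proof (rule ccontr)
    assume ne: "\<omega> a \<noteq> z"
    have "\<iota> (z - \<omega> a) \<in> I"
      using idl(5)[OF \<omega>[OF that(1)] that(2)] by (simp add: emb_diff)
    then have "\<iota> (inverse (z - \<omega> a)) * \<iota> (z - \<omega> a) \<in> I" by (intro idl(4)) auto
    then show False using ne I(2) by (simp flip: emb_mult)
  qed
  show ?thesis
  proof (intro exI[of _ \<omega>] conjI ballI allI)
    fix a b assume ab: "a \<in> A" "b \<in> A"
    show "\<omega> (a + b) = \<omega> a + \<omega> b"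
      using idl(3)[OF \<omega>[OF ab(1)] \<omega>[OF ab(2)]] ab by (intro uniq) (auto simp: emb_add algebra_simps)
    have "b * (a - \<iota> (\<omega> a)) + \<iota> (\<omega> a) * (b - \<iota> (\<omega> b)) \<in> I"
      using ab by (intro idl(3,4) \<omega>) auto
    then show "\<omega> (a * b) = \<omega> a * \<omega> b"
      using ab by (intro uniq) (auto simp: emb_mult algebra_simps)
  next
    show "\<omega> (\<iota> z) = z" for z using idl(2) by (intro uniq) auto
    show "\<omega> x = 0" if "x \<in> J" for x using that I(3) idl(1) by (intro uniq) auto
  qed
qed

end

section \<open>Uniform boundedness\<close>

text \<open>By Baire's theorem one of the closed sets \<open>B n\<close> contains a ball.
  Subtracting the value at its centre bounds all maps on vectors of norm \<open>e\<close>, and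
  scaling does the rest.\<close>

theorem uniform_boundedness:
  fixes F :: "('a::banach \<Rightarrow> 'b::real_normed_vector) set"
  assumes lin: "\<And>f. f \<in> F \<Longrightarrow> bounded_linear f" and bdd: "\<And>x. bounded ((\<lambda>f. f x) ` F)"
  shows "\<exists>K\<ge>0. \<forall>f\<in>F. \<forall>x. norm (f x) \<le> K * norm x"
proof -
  define B where "B n = {x. \<forall>f\<in>F. norm (f x) \<le> real n}" for n
  have closed: "closed (B n)" for n
  proof -
    have "B n = (\<Inter>f\<in>F. {x. norm (f x) \<le> real n})" by (auto simp: B_def)
    moreover have "closed {x. norm (f x) \<le> real n}" if "f \<in> F" for f
      using bounded_linear.continuous_on[OF lin[OF that] continuous_on_id]
      by (intro closed_Collect_le continuous_intros) auto
    ultimately show ?thesis by auto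
  qed
  have "x \<in> (\<Union>n. B n)" for x
  proof -
    obtain b where "\<forall>f\<in>F. norm (f x) \<le> b" using bdd[of x] by (auto simp: bounded_iff)
    moreover obtain n where "b \<le> real n" using real_arch_simple[of b] by blast
    ultimately have "x \<in> B n" by (force simp: B_def)
    then show ?thesis by blast
  qed
  then have "(\<Union>n. B n) = UNIV" by blast
  then have "\<exists>n. interior (B n) \<noteq> {}"
    using Baire_category_alt[of euclidean "range B"] closed completely_metrizable_space_euclidean
    by fastforce
  then obtain n x where "x \<in> interior (B n)" by blast
  then obtain e where e: "e > 0" "cball x e \<subseteq> B n"
    by (meson interior_subset open_contains_cball open_interior subset_trans)
  have "norm (f z) \<le> 2 * real n / e * norm z" if f: "f \<in> F" for f z
  proof (cases "z = 0")
    case True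
    then show ?thesis using lin[OF f] by (simp add: bounded_linear.linear linear_0)
  next
    case False
    interpret bounded_linear f by (rule lin[OF f])
    let ?c = "e / norm z"
    have "x + ?c *\<^sub>R z \<in> cball x e" using False e by (simp add: dist_norm)
    then have "norm (f (x + ?c *\<^sub>R z)) \<le> n" "norm (f x) \<le> n"
      using e f by (auto simp: B_def subset_iff)
    moreover have "f (?c *\<^sub>R z) = f (x + ?c *\<^sub>R z) - f x" by (simp add: add)
    ultimately have "norm (f (?c *\<^sub>R z)) \<le> 2 * real n"
      using norm_triangle_ineq4[of "f (x + ?c *\<^sub>R z)" "f x"] by simp
    moreover have "norm (f (?c *\<^sub>R z)) = ?c * norm (f z)" using False e by (simp add: scaleR)
    ultimately show ?thesis using False e by (simp add: field_simps)
  qed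
  then show ?thesis using e by (intro exI[of _ "2 * real n / e"]) auto
qed

section \<open>Regular Banach function algebras\<close>

text \<open>The pointwise ring structure lets function algebras instantiate the algebra locales; on
  complex functions its product agrees with \<open>pmult\<close>.\<close>

instantiation bcontfun :: (topological_space, real_normed_field) comm_ring_1
begin

definition times_bcontfun :: "('a \<Rightarrow>\<^sub>C 'b) \<Rightarrow> ('a \<Rightarrow>\<^sub>C 'b) \<Rightarrow> ('a \<Rightarrow>\<^sub>C 'b)"
  where "times_bcontfun f g = Bcontfun (\<lambda>x. apply_bcontfun f x * apply_bcontfun g x)"

definition one_bcontfun :: "'a \<Rightarrow>\<^sub>C 'b"
  where "one_bcontfun = const_bcontfun 1"

lemma apply_times_bcontfun:
  fixes f g :: "'a \<Rightarrow>\<^sub>C 'b"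
  shows "apply_bcontfun (f * g) x = apply_bcontfun f x * apply_bcontfun g x"
proof -
  have "(\<lambda>x. apply_bcontfun f x * apply_bcontfun g x) \<in> bcontfun"
  proof (rule bcontfun_normI)
    show "norm (apply_bcontfun f x * apply_bcontfun g x) \<le> norm f * norm g" for x
      unfolding norm_mult by (intro mult_mono norm_bounded norm_ge_zero)
  qed (intro continuous_intros continuous_on_apply_bcontfun)
  then show ?thesis by (simp add: times_bcontfun_def Bcontfun_inverse)
qed

lemma apply_one_bcontfun: "apply_bcontfun (1 :: 'a \<Rightarrow>\<^sub>C 'b) x = 1"
  by (simp add: one_bcontfun_def)

instance
proof
  show "(0 :: 'a \<Rightarrow>\<^sub>C 'b) \<noteq> 1"
    by (metis apply_one_bcontfun zero_bcontfun.rep_eq zero_neq_one)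
qed (auto intro!: bcontfun_eqI simp: apply_times_bcontfun apply_one_bcontfun algebra_simps)

end

lemma pmult_complex_eq_times: "f \<bullet>\<^sub>C g = f * g" for f g :: "'x::topological_space \<Rightarrow>\<^sub>C complex"
  by (rule bcontfun_eqI) (simp add: apply_pmult apply_times_bcontfun scaleC_complex_def)

lemma scaleC_eq_const_times: "c *\<^sub>C f = const_bcontfun c * f" for f :: "'x::topological_space \<Rightarrow>\<^sub>C complex"
  by (simp add: scaleC_bcontfun_def pmult_complex_eq_times)

lemma pmult_mult_left: "(a * b) \<bullet>\<^sub>C h = a \<bullet>\<^sub>C (b \<bullet>\<^sub>C h)"
  by (rule bcontfun_eqI) (simp add: apply_pmult apply_times_bcontfun scaleC_scaleC)

lemma pmult_add_left: "(a + b) \<bullet>\<^sub>C h = a \<bullet>\<^sub>C h + b \<bullet>\<^sub>C h"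
  by (rule bcontfun_eqI) (simp add: apply_pmult scaleC_add_left)

lemma pmult_one_left: "1 \<bullet>\<^sub>C h = h"
  by (rule bcontfun_eqI) (simp add: apply_pmult apply_one_bcontfun scaleC_one)

lemma pmult_zero_left: "0 \<bullet>\<^sub>C h = 0"
  by (rule bcontfun_eqI) (simp add: apply_pmult)

lemma banach_function_algebra_imp_banach_algebra_on:
  fixes A :: "('x::topological_space \<Rightarrow>\<^sub>C complex) set"
  assumes "banach_function_algebra A"
  shows "\<exists>N. banach_algebra_on A const_bcontfun N"
proof -
  obtain N where N: "banach_algebra_norm_on A N" using assms by (auto simp: banach_function_algebra_def)
  have "banach_algebra_on A const_bcontfun N"
  proof
    show "a \<in> A \<Longrightarrow> b \<in> A \<Longrightarrow> a + b \<in> A" for a b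
      using assms complex_vector.subspace_add by (auto simp: banach_function_algebra_def)
    show "const_bcontfun 1 = (1 :: 'x \<Rightarrow>\<^sub>C complex)" by (simp add: one_bcontfun_def)
    show "const_bcontfun (z + w) = (const_bcontfun z + const_bcontfun w :: 'x \<Rightarrow>\<^sub>C complex)"
      "const_bcontfun (z * w) = (const_bcontfun z * const_bcontfun w :: 'x \<Rightarrow>\<^sub>C complex)" for z w
      by (auto intro!: bcontfun_eqI simp: apply_times_bcontfun)
    show "\<exists>f\<in>A. (\<lambda>n. N (F n - f)) \<longlonglongrightarrow> 0"
      if "\<And>n. F n \<in> A" "\<forall>e>0. \<exists>n0. \<forall>m\<ge>n0. \<forall>n\<ge>n0. N (F m - F n) < e" for F
      using N that unfolding banach_algebra_norm_on_def by (metis image_subset_iff)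
  qed (use assms N in \<open>auto simp: banach_function_algebra_def banach_algebra_norm_on_def
      pmult_complex_eq_times scaleC_eq_const_times\<close>)
  then show ?thesis by blast
qed

lemma regular_banach_function_algebraE:
  assumes "regular_banach_function_algebra A" "\<phi> \<in> topspace (maximal_ideal_space A) - K"
    "closedin (maximal_ideal_space A) K"
  obtains f where "f \<in> A" "\<phi> f = 1" "\<forall>\<psi>\<in>K. \<psi> f = 0"
proof -
  have "\<exists>f\<in>A. gelfand_transform f \<phi> = 1 \<and> (\<forall>\<psi>\<in>K. gelfand_transform f \<psi> = 0)"
    using assms unfolding regular_banach_function_algebra_def by metis
  then show ?thesis using that by (auto simp: gelfand_transform_def)
qed

text \<open>Restricted to \<open>A\<close>, so that it is extensional as \<open>characters\<close>
  demands.\<close>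

definition evaluation_at ::
  "('x::topological_space \<Rightarrow>\<^sub>C complex) set \<Rightarrow> 'x \<Rightarrow> ('x \<Rightarrow>\<^sub>C complex) \<Rightarrow> complex"
  where "evaluation_at A x = restrict (\<lambda>f. apply_bcontfun f x) A"

lemma evaluation_at_in_characters:
  assumes "banach_function_algebra A"
  shows "evaluation_at A x \<in> characters A"
proof -
  have "const_bcontfun 1 \<in> A" using assms by (auto simp: banach_function_algebra_def)
  then have "\<exists>f\<in>A. evaluation_at A x f \<noteq> 0"
    by (intro bexI[of _ "const_bcontfun 1"]) (simp_all add: evaluation_at_def)
  moreover have "complex_vector.subspace A" "\<And>f g. f \<in> A \<Longrightarrow> g \<in> A \<Longrightarrow> f \<bullet>\<^sub>C g \<in> A"
    using assms by (auto simp: banach_function_algebra_def)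
  ultimately show ?thesis
    by (auto simp: characters_def clinear_on_def evaluation_at_def apply_pmult scaleC_complex_def
        apply_scaleC_bcontfun complex_vector.subspace_add complex_vector.subspace_scale)
qed

lemma continuous_map_evaluation_at:
  assumes "banach_function_algebra A"
  shows "continuous_map euclidean (maximal_ideal_space A) (evaluation_at A)"
  unfolding maximal_ideal_space_def continuous_map_in_subtopology continuous_map_componentwise
  using evaluation_at_in_characters[OF assms]
  by (auto simp: evaluation_at_def)

text \<open>A continuous image of a compact set in a Hausdorff space is closed. This makes
  regularity applicable to sets of point evaluations.\<close>

lemma closedin_evaluation_at_image:
  fixes A :: "('x::topological_space \<Rightarrow>\<^sub>C complex) set"
  assumes "compact (UNIV :: 'x set)" "banach_function_algebra A" "closed K"
  shows "closedin (maximal_ideal_space A) (evaluation_at A ` K)"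
proof (rule compactin_imp_closedin)
  show "Hausdorff_space (maximal_ideal_space A)"
    unfolding maximal_ideal_space_def
    by (intro Hausdorff_space_subtopology) (simp add: Hausdorff_space_product_topology)
  have "compactin euclidean K" using compact_Int_closed[OF assms(1,3)] by (simp add: compactin_euclidean_iff)
  then show "compactin (maximal_ideal_space A) (evaluation_at A ` K)"
    by (rule image_compactin[OF _ continuous_map_evaluation_at[OF assms(2)]])
qed

text \<open>Regularity is applied to the closed set of evaluations at points outside
  \<open>U\<close>; it omits evaluation at \<open>x\<close> because \<open>A\<close> separates
  points.\<close>

lemma regular_separation:
  fixes A :: "('x::topological_space \<Rightarrow>\<^sub>C complex) set"
  assumes "compact (UNIV :: 'x set)" "regular_banach_function_algebra A" "open U" "x \<in> U"
  shows "\<exists>f\<in>A. apply_bcontfun f x = 1 \<and> coz f \<subseteq> U"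
proof -
  have A: "banach_function_algebra A" using assms by (simp add: regular_banach_function_algebra_def)
  have "evaluation_at A x \<noteq> evaluation_at A z" if "z \<in> - U" for z
  proof -
    have "x \<noteq> z" using that assms by blast
    then obtain f where "f \<in> A" "apply_bcontfun f x \<noteq> apply_bcontfun f z"
      using A unfolding banach_function_algebra_def by blast
    then show ?thesis by (auto simp: evaluation_at_def restrict_def fun_eq_iff)
  qed
  then have "evaluation_at A x \<in> topspace (maximal_ideal_space A) - evaluation_at A ` (- U)"
    using evaluation_at_in_characters[OF A] by (auto simp: topspace_maximal_ideal_space)
  moreover have "closedin (maximal_ideal_space A) (evaluation_at A ` (- U))"
    using assms(3) by (intro closedin_evaluation_at_image[OF assms(1) A] closed_Compl)
  ultimately obtain f where f: "f \<in> A" "evaluation_at A x f = 1"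
    "\<forall>\<psi>\<in>evaluation_at A ` (- U). \<psi> f = 0"
    by (rule regular_banach_function_algebraE[OF assms(2)])
  have "apply_bcontfun f x = 1" using f(1,2) by (simp add: evaluation_at_def)
  moreover have "apply_bcontfun f z = 0" if "z \<notin> U" for z
  proof -
    have "evaluation_at A z f = 0" using f(3) that by blast
    then show ?thesis using f(1) by (simp add: evaluation_at_def)
  qed
  ultimately show ?thesis using f(1) by (intro bexI[of _ f]) (auto simp: coz_def)
qed

text \<open>The point evaluations form a closed set of characters. Regularity would separate any
  other character from them by a function vanishing at every point, that is, by
  \<open>0\<close>.\<close>

lemma characters_regular_banach_function_algebra:
  fixes A :: "('x::topological_space \<Rightarrow>\<^sub>C complex) set"
  assumes "compact (UNIV :: 'x set)" "regular_banach_function_algebra A"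
  shows "characters A = range (evaluation_at A)"
proof (intro equalityI subsetI)
  have A: "banach_function_algebra A" using assms by (simp add: regular_banach_function_algebra_def)
  then have "complex_vector.subspace A" by (simp add: banach_function_algebra_def)
  then have "0 \<in> A" by (rule complex_vector.subspace_0)
  show "\<omega> \<in> characters A" if "\<omega> \<in> range (evaluation_at A)" for \<omega>
    using that evaluation_at_in_characters[OF A] by auto
  fix \<omega> assume \<omega>: "\<omega> \<in> characters A"
  show "\<omega> \<in> range (evaluation_at A)"
  proof (rule ccontr)
    assume "\<omega> \<notin> range (evaluation_at A)"
    then have "\<omega> \<in> topspace (maximal_ideal_space A) - range (evaluation_at A)"
      using \<omega> by (simp add: topspace_maximal_ideal_space)
    moreover have "closedin (maximal_ideal_space A) (range (evaluation_at A))"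
      by (intro closedin_evaluation_at_image[OF assms(1) A]) simp
    ultimately obtain f where f: "f \<in> A" "\<omega> f = 1" "\<forall>\<psi>\<in>range (evaluation_at A). \<psi> f = 0"
      by (rule regular_banach_function_algebraE[OF assms(2)])
    then have "f = 0" by (intro bcontfun_eqI) (simp add: evaluation_at_def)
    moreover have "\<omega> (0 + 0) = \<omega> 0 + \<omega> 0"
      using \<omega> \<open>0 \<in> A\<close> unfolding characters_def clinear_on_def by blast
    ultimately show False using f by simp
  qed
qed

text \<open>Some character annihilates \<open>J\<close>, and it is evaluation at a point.\<close>

lemma proper_ideal_common_zero:
  fixes A :: "('x::topological_space \<Rightarrow>\<^sub>C complex) set"
  assumes "compact (UNIV :: 'x set)" "regular_banach_function_algebra A"
    and J: "J \<subseteq> A" "0 \<in> J" "\<And>a b. a \<in> J \<Longrightarrow> b \<in> J \<Longrightarrow> a + b \<in> J" "\<And>a b. a \<in> A \<Longrightarrow> b \<in> J \<Longrightarrow> a * b \<in> J"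
    and "1 \<notin> J"
  shows "\<exists>x. \<forall>a\<in>J. apply_bcontfun a x = 0"
proof -
  have A: "banach_function_algebra A" using assms by (simp add: regular_banach_function_algebra_def)
  then obtain N where "banach_algebra_on A const_bcontfun N"
    using banach_function_algebra_imp_banach_algebra_on by blast
  then interpret banach_algebra_on A const_bcontfun N .
  have "ideal_on J" using J by (auto simp: ideal_on_def)
  then obtain \<omega> where \<omega>: "\<forall>a\<in>A. \<forall>b\<in>A. \<omega> (a + b) = \<omega> a + \<omega> b" "\<forall>a\<in>A. \<forall>b\<in>A. \<omega> (a * b) = \<omega> a * \<omega> b"
    "\<forall>z. \<omega> (const_bcontfun z) = z" "\<forall>a\<in>J. \<omega> a = 0"
    using character_on_proper_ideal \<open>1 \<notin> J\<close> by blast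
  have "restrict \<omega> A (const_bcontfun 1) \<noteq> 0" using \<omega>(3) by (simp del: emb_one)
  then have "restrict \<omega> A \<in> characters A"
    using \<omega> unfolding characters_def clinear_on_def
    by (auto simp: pmult_complex_eq_times scaleC_eq_const_times scaleC_complex_def
        intro!: bexI[of _ "const_bcontfun 1"])
  then obtain x where x: "restrict \<omega> A = evaluation_at A x"
    using characters_regular_banach_function_algebra[OF assms(1,2)] by auto
  have "apply_bcontfun a x = 0" if "a \<in> J" for a
  proof -
    have "a \<in> A" "\<omega> a = 0" using that \<omega>(4) J(1) by blast+
    then show ?thesis using fun_cong[OF x, of a] by (simp add: evaluation_at_def)
  qed
  then show ?thesis by blast
qed

section \<open>Support points of jointly separating operators\<close>

lemma clinear_on_diff:
  assumes "clinear_on M T" "complex_vector.subspace M" "f \<in> M" "g \<in> M"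
  shows "T (f - g) = T f - T g"
proof -
  have "T (f + (- 1) *\<^sub>C g) = T f + (- 1) *\<^sub>C T g"
    using assms complex_vector.subspace_scale[OF assms(2,4), of "- 1"] unfolding clinear_on_def by metis
  then show ?thesis by simp
qed

lemma clinear_on_zero:
  assumes "clinear_on M T" "complex_vector.subspace M"
  shows "T 0 = 0"
  using clinear_on_diff[OF assms, of 0 0] complex_vector.subspace_0[OF assms(2)] by simp

lemma clinear_on_continuous_imp_bounded:
  fixes T :: "'a::complex_normed_vector \<Rightarrow> 'b::complex_normed_vector"
  assumes T: "clinear_on M T" and M: "complex_vector.subspace M" and cont: "continuous_on M T"
  shows "\<exists>K. \<forall>f\<in>M. norm (T f) \<le> K * norm f"
proof -
  have "0 \<in> M" using M by (rule complex_vector.subspace_0)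
  then obtain d where d: "d > 0" "\<And>f. f \<in> M \<Longrightarrow> dist f 0 < d \<Longrightarrow> dist (T f) (T 0) < 1"
    using cont unfolding continuous_on_iff by (metis zero_less_one)
  have "norm (T f) \<le> 2 / d * norm f" if f: "f \<in> M" for f
  proof (cases "f = 0")
    case False
    \<comment> \<open>This scalar brings \<open>f\<close> to norm \<open>d / 2\<close>, strictly
      inside the ball where \<open>T\<close> is controlled.\<close>
    let ?c = "complex_of_real (d / (2 * norm f))"
    have "norm (?c *\<^sub>C f) = d / 2" using False d by (simp add: norm_scaleC norm_divide norm_mult)
    then have "norm (T (?c *\<^sub>C f)) < 1"
      using d(2)[of "?c *\<^sub>C f"] d(1) complex_vector.subspace_scale[OF M f] clinear_on_zero[OF T M]
      by (simp add: dist_norm)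
    moreover have "T (?c *\<^sub>C f) = ?c *\<^sub>C T f" using T f by (simp add: clinear_on_def)
    ultimately have "d / (2 * norm f) * norm (T f) < 1"
      using d by (simp add: norm_scaleC norm_divide norm_mult)
    then show ?thesis using False d by (simp add: field_simps)
  qed (simp add: clinear_on_zero[OF T M])
  then show ?thesis by blast
qed

lemma clinear_on_apply:
  assumes "clinear_on M T"
  shows "clinear_on M (\<lambda>f. apply_bcontfun (T f) y)"
  using assms by (simp add: clinear_on_def apply_scaleC_bcontfun)

text \<open>The point is a common zero of the ideal \<open>J\<close> of multipliers annihilated by
  \<open>t\<close>. A function \<open>a\<close> in \<open>A\<close> with value \<open>1\<close>
  there and cozero set in \<open>U\<close> lies outside \<open>J\<close>, so some product of
  \<open>a\<close> with a member of \<open>M\<close> serves as the witness.\<close>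

lemma support_point:
  fixes A :: "('x::topological_space \<Rightarrow>\<^sub>C complex) set" and M :: "('x \<Rightarrow>\<^sub>C 'e::complex_normed_vector) set"
    and t :: "('x \<Rightarrow>\<^sub>C 'e) \<Rightarrow> complex"
  assumes X: "compact (UNIV :: 'x set)" and A: "regular_banach_function_algebra A"
    and M: "complex_vector.subspace M" "\<And>f h. f \<in> A \<Longrightarrow> h \<in> M \<Longrightarrow> f \<bullet>\<^sub>C h \<in> M"
    and t: "clinear_on M t" "\<exists>f\<in>M. t f \<noteq> 0"
  shows "\<exists>x. \<forall>U. open U \<longrightarrow> x \<in> U \<longrightarrow> (\<exists>f\<in>M. coz f \<subseteq> U \<and> t f \<noteq> 0)"
proof -
  define J where "J = {a\<in>A. \<forall>h\<in>M. t (a \<bullet>\<^sub>C h) = 0}"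
  have Asub: "complex_vector.subspace A" and Amult: "\<And>f g. f \<in> A \<Longrightarrow> g \<in> A \<Longrightarrow> f * g \<in> A"
    using A by (auto simp: regular_banach_function_algebra_def banach_function_algebra_def pmult_complex_eq_times)
  have "\<exists>x. \<forall>a\<in>J. apply_bcontfun a x = 0"
  proof (rule proper_ideal_common_zero[OF X A])
    show "0 \<in> J"
      using complex_vector.subspace_0[OF Asub] by (auto simp: J_def pmult_zero_left clinear_on_zero[OF t(1) M(1)])
    show "a + b \<in> J" if "a \<in> J" "b \<in> J" for a b
      using that t(1) M(2) complex_vector.subspace_add[OF Asub]
      by (auto simp: J_def pmult_add_left clinear_on_def)
    show "a * b \<in> J" if "a \<in> A" "b \<in> J" for a b
    proof -
      have "t ((a * b) \<bullet>\<^sub>C h) = 0" if "h \<in> M" for h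
        \<comment> \<open>Commuting the factors makes \<open>b\<close> act on
          \<open>a \<bullet>\<^sub>C h\<close>, which is again in \<open>M\<close>.\<close>
        using \<open>a \<in> A\<close> \<open>b \<in> J\<close> that M(2) by (subst mult.commute) (auto simp: J_def pmult_mult_left)
      then show ?thesis using that Amult by (auto simp: J_def)
    qed
    show "1 \<notin> J" using t(2) by (auto simp: J_def pmult_one_left)
  qed (auto simp: J_def)
  then obtain x where x: "\<And>a. a \<in> J \<Longrightarrow> apply_bcontfun a x = 0" by blast
  have "\<exists>f\<in>M. coz f \<subseteq> U \<and> t f \<noteq> 0" if U: "open U" "x \<in> U" for U
  proof -
    obtain a where a: "a \<in> A" "apply_bcontfun a x = 1" "coz a \<subseteq> U"
      using regular_separation[OF X A U] by blast
    then have "a \<notin> J" using x[of a] by auto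
    then obtain h where "h \<in> M" "t (a \<bullet>\<^sub>C h) \<noteq> 0" using a by (auto simp: J_def)
    moreover have "coz (a \<bullet>\<^sub>C h) \<subseteq> U" using a(3) by (auto simp: coz_def apply_pmult)
    ultimately show ?thesis using M(2) a(1) by blast
  qed
  then show ?thesis by blast
qed

text \<open>Different support points for \<open>T\<close> and \<open>S\<close> have disjoint
  neighbourhoods, and functions living there would violate joint separation.\<close>

lemma joint_support_point:
  fixes A :: "('x::t2_space \<Rightarrow>\<^sub>C complex) set" and M :: "('x \<Rightarrow>\<^sub>C 'e::complex_normed_vector) set"
    and T S :: "('x \<Rightarrow>\<^sub>C 'e) \<Rightarrow> ('y::topological_space \<Rightarrow>\<^sub>C complex)"
  assumes X: "compact (UNIV :: 'x set)" and A: "regular_banach_function_algebra A"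
    and M: "complex_vector.subspace M" "\<And>f h. f \<in> A \<Longrightarrow> h \<in> M \<Longrightarrow> f \<bullet>\<^sub>C h \<in> M"
    and TS: "clinear_on M T" "clinear_on M S" "jointly_separating M T S"
    and y: "y \<in> (\<Union>f\<in>M. coz (T f)) \<inter> (\<Union>f\<in>M. coz (S f))"
  shows "\<exists>x. \<forall>U. open U \<longrightarrow> x \<in> U \<longrightarrow>
    (\<exists>f\<in>M. coz f \<subseteq> U \<and> y \<in> coz (T f)) \<and> (\<forall>f\<in>M. coz f \<inter> U = {} \<longrightarrow> y \<notin> coz (T f) \<and> y \<notin> coz (S f))"
proof -
  have sep: "y \<notin> coz (T f) \<or> y \<notin> coz (S g)" if "f \<in> M" "g \<in> M" "coz f \<inter> coz g = {}" for f g
    using TS(3) that by (auto simp: jointly_separating_def)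
  obtain x where x: "\<And>U. open U \<Longrightarrow> x \<in> U \<Longrightarrow> \<exists>f\<in>M. coz f \<subseteq> U \<and> y \<in> coz (T f)"
    using support_point[OF X A M clinear_on_apply[OF TS(1), of y]] y by (auto simp: coz_def)
  obtain x' where x': "\<And>U. open U \<Longrightarrow> x' \<in> U \<Longrightarrow> \<exists>f\<in>M. coz f \<subseteq> U \<and> y \<in> coz (S f)"
    using support_point[OF X A M clinear_on_apply[OF TS(2), of y]] y by (auto simp: coz_def)
  have "x' = x"
  proof (rule ccontr)
    assume "x' \<noteq> x"
    then obtain U V where UV: "open U" "open V" "x \<in> U" "x' \<in> V" "U \<inter> V = {}" by (metis hausdorff)
    then obtain f g where "f \<in> M" "coz f \<subseteq> U" "y \<in> coz (T f)" "g \<in> M" "coz g \<subseteq> V" "y \<in> coz (S g)"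
      using x x' by meson
    then show False using sep[of f g] UV(5) by blast
  qed
  have "y \<notin> coz (T f) \<and> y \<notin> coz (S f)" if U: "open U" "x \<in> U" and f: "f \<in> M" "coz f \<inter> U = {}" for U f
  proof -
    \<comment> \<open>Near the common point \<open>g\<close> witnesses \<open>T\<close> and
      \<open>h\<close> witnesses \<open>S\<close>. Separating \<open>f\<close> from \<open>h\<close>
      kills \<open>T f\<close> at \<open>y\<close>, and separating \<open>g\<close> from
      \<open>f\<close> kills \<open>S f\<close>.\<close>
    obtain g h where "g \<in> M" "coz g \<subseteq> U" "y \<in> coz (T g)" "h \<in> M" "coz h \<subseteq> U" "y \<in> coz (S h)"
      using x[OF U] x'[of U] U \<open>x' = x\<close> by meson
    then show ?thesis using sep[of f h] sep[of g f] f by blast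
  qed
  then show ?thesis using x by blast
qed

theorem theorem3p12:
  fixes A :: "('x::t2_space \<Rightarrow>\<^sub>C complex) set"
    and M :: "('x \<Rightarrow>\<^sub>C 'e::complex_banach) set"
    and T S :: "('x \<Rightarrow>\<^sub>C 'e) \<Rightarrow> ('y::t2_space \<Rightarrow>\<^sub>C complex)"
  assumes "compact (UNIV :: 'x set)"
    and "compact (UNIV :: 'y set)"
    and "complex_vector.subspace M"
    and "\<And>e. const_bcontfun e \<in> M"
    and "regular_banach_function_algebra A"
    and "\<And>f h. f \<in> A \<Longrightarrow> h \<in> M \<Longrightarrow> f \<bullet>\<^sub>C h \<in> M"
    and "property_P M norm"
    and "clinear_on M T"
    and "clinear_on M S"
    and "jointly_separating M T S"
  shows "\<exists>(Y0 :: 'y set) Yc Yd (\<phi> :: 'y \<Rightarrow> 'x)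
            (\<Lambda>T :: 'y \<Rightarrow> 'e \<Rightarrow> complex) (\<Lambda>S :: 'y \<Rightarrow> 'e \<Rightarrow> complex).
      Y0 \<union> Yc \<union> Yd = UNIV \<and> Y0 \<inter> Yc = {} \<and> Y0 \<inter> Yd = {} \<and> Yc \<inter> Yd = {} \<and>
      closed Y0 \<and> open Yd \<and>
      continuous_on (Yc \<union> Yd) \<phi> \<and>
      (\<forall>y\<in>Yc. \<Lambda>T y \<in> dual_space \<and> \<Lambda>S y \<in> dual_space) \<and>
      (\<forall>f\<in>M. \<forall>y\<in>Yc. apply_bcontfun (T f) y = \<Lambda>T y (apply_bcontfun f (\<phi> y))) \<and>
      (\<forall>f\<in>M. \<forall>y\<in>Yc. apply_bcontfun (S f) y = \<Lambda>S y (apply_bcontfun f (\<phi> y))) \<and>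
      (continuous_on M T \<and> continuous_on M S \<longrightarrow>
         Yd = {} \<and> Yc = (\<Union>f\<in>M. coz (T f)) \<inter> (\<Union>f\<in>M. coz (S f)))"
proof -
  note X = assms(1) and M = assms(3) and const = assms(4) and A = assms(5) and AM = assms(6)
    and P = assms(7) and T = assms(8) and S = assms(9) and sep = assms(10)

  \<comment> \<open>The support map on the set where both functionals are nonzero\<close>
  define G where "G = (\<Union>f\<in>M. coz (T f)) \<inter> (\<Union>f\<in>M. coz (S f))"
  have open_coz: "open (coz f)" for f :: "'y \<Rightarrow>\<^sub>C complex"
    unfolding coz_def by (intro open_Collect_neq continuous_on_apply_bcontfun continuous_on_const)
  have "open G" unfolding G_def using open_coz by (intro open_Int open_UN) auto
  have "\<forall>y. \<exists>x. y \<in> G \<longrightarrow> (\<forall>U. open U \<longrightarrow> x \<in> U \<longrightarrow>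
    (\<exists>f\<in>M. coz f \<subseteq> U \<and> y \<in> coz (T f)) \<and> (\<forall>f\<in>M. coz f \<inter> U = {} \<longrightarrow> y \<notin> coz (T f) \<and> y \<notin> coz (S f)))"
    using joint_support_point[OF X A M AM T S sep] unfolding G_def by blast
  then obtain \<phi> where \<phi>: "\<And>y U. y \<in> G \<Longrightarrow> open U \<Longrightarrow> \<phi> y \<in> U \<Longrightarrow>
    (\<exists>f\<in>M. coz f \<subseteq> U \<and> y \<in> coz (T f)) \<and> (\<forall>f\<in>M. coz f \<inter> U = {} \<longrightarrow> y \<notin> coz (T f) \<and> y \<notin> coz (S f))"
    by metis

  \<comment> \<open>Continuity of the support map\<close>
  have cont_\<phi>: "continuous_on G \<phi>"
    unfolding continuous_on_topological
  proof (intro ballI allI impI)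
    fix y0 V assume y0: "y0 \<in> G" and V: "open V" "\<phi> y0 \<in> V"
    obtain a where a: "a \<in> A" "apply_bcontfun a (\<phi> y0) = 1" "coz a \<subseteq> V"
      using regular_separation[OF X A V] by blast
    \<comment> \<open>A cozero set inside \<open>V\<close> would only place \<open>\<phi> y\<close>
      in its closure. Inside \<open>W\<close> it stays away from a neighbourhood of each zero of
      \<open>a\<close>, which excludes \<open>\<phi> y\<close> outside \<open>V\<close>.\<close>
    define W where "W = {x. 1/2 < norm (apply_bcontfun a x)}"
    have "open W" unfolding W_def
      by (intro open_Collect_less continuous_intros continuous_on_apply_bcontfun)
    moreover have "\<phi> y0 \<in> W" using a by (simp add: W_def)
    ultimately obtain f where f: "f \<in> M" "coz f \<subseteq> W" "y0 \<in> coz (T f)" using \<phi>[OF y0] by blast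
    have "\<phi> y \<in> V" if y: "y \<in> G" "y \<in> coz (T f)" for y
    proof (rule ccontr)
      assume "\<phi> y \<notin> V"
      then have "apply_bcontfun a (\<phi> y) = 0" using a(3) by (auto simp: coz_def)
      moreover have "open {x. norm (apply_bcontfun a x) < 1/2}"
        by (intro open_Collect_less continuous_intros continuous_on_apply_bcontfun)
      moreover have "coz f \<inter> {x. norm (apply_bcontfun a x) < 1/2} = {}"
        using f(2) by (auto simp: W_def)
      ultimately show False using \<phi>[OF y(1), of "{x. norm (apply_bcontfun a x) < 1/2}"] f(1) y(2) by simp
    qed
    then show "\<exists>U. open U \<and> y0 \<in> U \<and> (\<forall>y\<in>G. y \<in> U \<longrightarrow> \<phi> y \<in> V)"
      using open_coz f(3) by blast
  qed

  \<comment> \<open>Representation where both functionals are bounded\<close>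
  define D where "D K = {y. \<forall>f\<in>M. norm (apply_bcontfun (T f) y) \<le> K * norm f \<and>
      norm (apply_bcontfun (S f) y) \<le> K * norm f}" for K
  define Yc where "Yc = G \<inter> (\<Union>K. D K)"
  define \<Lambda>T where "\<Lambda>T y e = apply_bcontfun (T (const_bcontfun e)) y" for y e
  define \<Lambda>S where "\<Lambda>S y e = apply_bcontfun (S (const_bcontfun e)) y" for y e
  \<comment> \<open>Subtracting the constant gives a function vanishing at \<open>\<phi> y\<close>.
    Property (P) approximates it by functions vanishing near \<open>\<phi> y\<close>, which
    \<open>R\<close> sends to functions vanishing at \<open>y\<close>; boundedness passes this to
    the limit.\<close>
  have local_value: "apply_bcontfun (R f) y = apply_bcontfun (R (const_bcontfun (apply_bcontfun f (\<phi> y)))) y"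
    if R: "clinear_on M R" and K: "\<And>f. f \<in> M \<Longrightarrow> norm (apply_bcontfun (R f) y) \<le> K * norm f"
      and loc: "\<And>f U. f \<in> M \<Longrightarrow> open U \<Longrightarrow> \<phi> y \<in> U \<Longrightarrow> coz f \<inter> U = {} \<Longrightarrow> y \<notin> coz (R f)"
      and f: "f \<in> M"
    for R :: "('x \<Rightarrow>\<^sub>C 'e) \<Rightarrow> ('y \<Rightarrow>\<^sub>C complex)" and y K f
  proof -
    let ?c = "const_bcontfun (apply_bcontfun f (\<phi> y)) :: 'x \<Rightarrow>\<^sub>C 'e"
    have g: "f - ?c \<in> M" using f const by (intro complex_vector.subspace_diff[OF M])
    moreover have "apply_bcontfun (f - ?c) (\<phi> y) = 0" by simp
    ultimately obtain F where F: "\<And>n. F n \<in> M"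
      "\<And>n. \<exists>U. open U \<and> \<phi> y \<in> U \<and> (\<forall>z\<in>U. apply_bcontfun (F n) z = 0)"
      "(\<lambda>n. norm (F n - (f - ?c))) \<longlonglongrightarrow> 0"
      using P unfolding property_P_def by metis
    have "norm (apply_bcontfun (R (f - ?c)) y) \<le> K * norm (F n - (f - ?c))" for n
    proof -
      obtain U where "open U" "\<phi> y \<in> U" "\<forall>z\<in>U. apply_bcontfun (F n) z = 0" using F(2) by blast
      then have "apply_bcontfun (R (F n)) y = 0" using loc[OF F(1), of U n] by (auto simp: coz_def)
      then have "apply_bcontfun (R (f - ?c)) y = apply_bcontfun (R (f - ?c - F n)) y"
        using clinear_on_diff[OF R M g F(1), of n] by simp
      also have "norm \<dots> \<le> K * norm (f - ?c - F n)"
        by (intro K complex_vector.subspace_diff[OF M, of "f - ?c"] g F(1))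
      finally show ?thesis by (simp add: norm_minus_commute)
    qed
    then have le: "\<exists>N. \<forall>n\<ge>N. norm (apply_bcontfun (R (f - ?c)) y) \<le> K * norm (F n - (f - ?c))" by blast
    have "norm (apply_bcontfun (R (f - ?c)) y) \<le> K * 0"
      by (rule LIMSEQ_le_const[OF tendsto_mult_left[OF F(3)] le])
    then show ?thesis using clinear_on_diff[OF R M f const, of "apply_bcontfun f (\<phi> y)"] by simp
  qed
  have rep: "apply_bcontfun (T f) y = \<Lambda>T y (apply_bcontfun f (\<phi> y))"
      "apply_bcontfun (S f) y = \<Lambda>S y (apply_bcontfun f (\<phi> y))" if f: "f \<in> M" and y: "y \<in> Yc" for f y
  proof -
    obtain K where K: "\<And>f. f \<in> M \<Longrightarrow> norm (apply_bcontfun (T f) y) \<le> K * norm f"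
        "\<And>f. f \<in> M \<Longrightarrow> norm (apply_bcontfun (S f) y) \<le> K * norm f" and yG: "y \<in> G"
      using y by (auto simp: Yc_def D_def)
    show "apply_bcontfun (T f) y = \<Lambda>T y (apply_bcontfun f (\<phi> y))"
      unfolding \<Lambda>T_def using \<phi>[OF yG] by (intro local_value[OF T K(1) _ f]) auto
    show "apply_bcontfun (S f) y = \<Lambda>S y (apply_bcontfun f (\<phi> y))"
      unfolding \<Lambda>S_def using \<phi>[OF yG] by (intro local_value[OF S K(2) _ f]) auto
  qed

  \<comment> \<open>Uniform bounds on the values at constant functions\<close>
  have const_simps: "const_bcontfun (a + b) = (const_bcontfun a + const_bcontfun b :: 'x \<Rightarrow>\<^sub>C 'e)"
    "const_bcontfun (c *\<^sub>C a) = (c *\<^sub>C const_bcontfun a :: 'x \<Rightarrow>\<^sub>C 'e)" for a b :: 'e and c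
    by (auto intro!: bcontfun_eqI simp: apply_scaleC_bcontfun)
  have lin_const: "clinear_on UNIV (\<lambda>e. apply_bcontfun (R (const_bcontfun e)) y)"
    if "clinear_on M R" for R :: "('x \<Rightarrow>\<^sub>C 'e) \<Rightarrow> ('y \<Rightarrow>\<^sub>C complex)" and y
    using that const unfolding clinear_on_def by (simp add: const_simps apply_scaleC_bcontfun)
  have norm_const: "norm (const_bcontfun e :: 'x \<Rightarrow>\<^sub>C 'e) \<le> norm e" for e
    by (rule norm_bound) simp
  have bl: "bounded_linear (\<lambda>e. apply_bcontfun (R (const_bcontfun e)) y)"
    if R: "clinear_on M R" and K: "\<And>f. f \<in> M \<Longrightarrow> norm (apply_bcontfun (R f) y) \<le> K * norm f"
    for R :: "('x \<Rightarrow>\<^sub>C 'e) \<Rightarrow> ('y \<Rightarrow>\<^sub>C complex)" and y K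
  proof (rule bounded_linear_intro)
    let ?L = "\<lambda>e. apply_bcontfun (R (const_bcontfun e)) y"
    note L = lin_const[OF R, of y, unfolded clinear_on_def]
    show "?L (a + b) = ?L a + ?L b" for a b using L by blast
    show "?L (r *\<^sub>R a) = r *\<^sub>R ?L a" for r a
      using L by (metis UNIV_I scaleC_of_real)
    \<comment> \<open>The absolute value is taken because the sign of \<open>K\<close> is not
      known.\<close>
    show "norm (?L e) \<le> norm e * \<bar>K\<bar>" for e
    proof -
      have "norm (?L e) \<le> K * norm (const_bcontfun e :: 'x \<Rightarrow>\<^sub>C 'e)" by (intro K const)
      also have "\<dots> \<le> \<bar>K\<bar> * norm e" by (intro mult_mono norm_const) auto
      finally show ?thesis by (simp add: mult.commute)
    qed
  qed
  have blTS: "bounded_linear (\<Lambda>T y)" "bounded_linear (\<Lambda>S y)" if y: "y \<in> Yc" for y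
  proof -
    obtain K where K: "\<And>f. f \<in> M \<Longrightarrow> norm (apply_bcontfun (T f) y) \<le> K * norm f"
        "\<And>f. f \<in> M \<Longrightarrow> norm (apply_bcontfun (S f) y) \<le> K * norm f"
      using y by (auto simp: Yc_def D_def)
    show "bounded_linear (\<Lambda>T y)" "bounded_linear (\<Lambda>S y)"
      unfolding \<Lambda>T_def \<Lambda>S_def using bl[OF T K(1)] bl[OF S K(2)] by auto
  qed
  have unif: "\<exists>K\<ge>0. \<forall>y\<in>Yc. \<forall>e. norm (apply_bcontfun (R (const_bcontfun e)) y) \<le> K * norm e"
    if "\<And>y. y \<in> Yc \<Longrightarrow> bounded_linear (\<lambda>e. apply_bcontfun (R (const_bcontfun e)) y)"
    for R :: "('x \<Rightarrow>\<^sub>C 'e) \<Rightarrow> ('y \<Rightarrow>\<^sub>C complex)"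
  proof -
    \<comment> \<open>For fixed \<open>e\<close> the values at all points \<open>y\<close> are
      bounded by the supremum norm of \<open>R (const_bcontfun e)\<close>.\<close>
    have "bounded ((\<lambda>l. l e) ` ((\<lambda>y e. apply_bcontfun (R (const_bcontfun e)) y) ` Yc))" for e
      by (auto simp: bounded_iff intro!: exI[of _ "norm (R (const_bcontfun e))"] norm_bounded)
    then have "\<exists>K\<ge>0. \<forall>l\<in>(\<lambda>y e. apply_bcontfun (R (const_bcontfun e)) y) ` Yc. \<forall>x. norm (l x) \<le> K * norm x"
      using that by (intro uniform_boundedness) auto
    then show ?thesis by auto
  qed
  obtain KT KS where K: "KT \<ge> 0" "KS \<ge> 0" "\<And>y e. y \<in> Yc \<Longrightarrow> norm (\<Lambda>T y e) \<le> KT * norm e"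
    "\<And>y e. y \<in> Yc \<Longrightarrow> norm (\<Lambda>S y e) \<le> KS * norm e"
    using unif[of T] unif[of S] blTS unfolding \<Lambda>T_def \<Lambda>S_def by blast
  \<comment> \<open>On \<open>Yc\<close> each functional factors through the value at
    \<open>\<phi> y\<close>, so the uniform bounds on constants hold for all of \<open>M\<close>.
    Thus a single closed set \<open>D (KT + KS)\<close> replaces the union, and
    \<open>G - Yc\<close> is open.\<close>
  have Yc_eq: "Yc = G \<inter> D (KT + KS)"
  proof (intro equalityI subsetI)
    fix y assume y: "y \<in> Yc"
    have "norm (apply_bcontfun (T f) y) \<le> (KT + KS) * norm f"
      "norm (apply_bcontfun (S f) y) \<le> (KT + KS) * norm f" if f: "f \<in> M" for f
    proof -
      have "norm (apply_bcontfun (T f) y) \<le> KT * norm (apply_bcontfun f (\<phi> y))"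
        "norm (apply_bcontfun (S f) y) \<le> KS * norm (apply_bcontfun f (\<phi> y))"
        using rep[OF f y] K(3,4)[OF y] by auto
      moreover have "KT * norm (apply_bcontfun f (\<phi> y)) \<le> (KT + KS) * norm f"
        "KS * norm (apply_bcontfun f (\<phi> y)) \<le> (KT + KS) * norm f"
        using K(1,2) by (intro mult_mono norm_bounded; simp)+
      ultimately show "norm (apply_bcontfun (T f) y) \<le> (KT + KS) * norm f"
        "norm (apply_bcontfun (S f) y) \<le> (KT + KS) * norm f" by linarith+
    qed
    then show "y \<in> G \<inter> D (KT + KS)" using y by (simp add: Yc_def D_def)
  qed (auto simp: Yc_def)
  have "closed (D K)" for K
  proof -
    have "D K = (\<Inter>f\<in>M. {y. norm (apply_bcontfun (T f) y) \<le> K * norm f} \<inter>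
        {y. norm (apply_bcontfun (S f) y) \<le> K * norm f})"
      by (auto simp: D_def)
    then show ?thesis
      by (auto intro!: closed_Collect_le continuous_intros closed_Int closed_INT continuous_on_apply_bcontfun)
  qed
  then have "open (G - Yc)"
    using \<open>open G\<close> by (simp add: Yc_eq Diff_Int open_Diff)

  \<comment> \<open>The partition and the case of continuous operators\<close>
  show ?thesis
  proof (rule exI[of _ "- G"], rule exI[of _ Yc], rule exI[of _ "G - Yc"], rule exI[of _ \<phi>],
      rule exI[of _ \<Lambda>T], rule exI[of _ \<Lambda>S], intro conjI)
    have "Yc \<subseteq> G" by (auto simp: Yc_def)
    then show "- G \<union> Yc \<union> (G - Yc) = UNIV" "- G \<inter> Yc = {}" "- G \<inter> (G - Yc) = {}" "Yc \<inter> (G - Yc) = {}"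
      by auto
    show "closed (- G)" using \<open>open G\<close> by (rule closed_Compl)
    show "open (G - Yc)" by fact
    show "continuous_on (Yc \<union> (G - Yc)) \<phi>"
      using cont_\<phi> \<open>Yc \<subseteq> G\<close> by (simp add: Un_absorb1)
    show "\<forall>y\<in>Yc. \<Lambda>T y \<in> dual_space \<and> \<Lambda>S y \<in> dual_space"
      using blTS lin_const[OF T] lin_const[OF S] unfolding dual_space_def \<Lambda>T_def \<Lambda>S_def
      by (auto intro: linear_continuous_on)
    show "\<forall>f\<in>M. \<forall>y\<in>Yc. apply_bcontfun (T f) y = \<Lambda>T y (apply_bcontfun f (\<phi> y))"
      "\<forall>f\<in>M. \<forall>y\<in>Yc. apply_bcontfun (S f) y = \<Lambda>S y (apply_bcontfun f (\<phi> y))"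
      using rep by auto
    show "continuous_on M T \<and> continuous_on M S \<longrightarrow>
        G - Yc = {} \<and> Yc = (\<Union>f\<in>M. coz (T f)) \<inter> (\<Union>f\<in>M. coz (S f))"
    proof
      assume "continuous_on M T \<and> continuous_on M S"
      then obtain K1 K2 where K12: "\<And>f. f \<in> M \<Longrightarrow> norm (T f) \<le> K1 * norm f" "\<And>f. f \<in> M \<Longrightarrow> norm (S f) \<le> K2 * norm f"
        using clinear_on_continuous_imp_bounded[OF T M] clinear_on_continuous_imp_bounded[OF S M] by blast
      \<comment> \<open>Operator bounds control both functionals at every point at once, so nothing
        of \<open>G\<close> is left outside \<open>Yc\<close>.\<close>
      have "y \<in> D (max K1 K2)" for y
      proof -
        have "norm (apply_bcontfun (T f) y) \<le> max K1 K2 * norm f \<and> norm (apply_bcontfun (S f) y) \<le> max K1 K2 * norm f"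
          if f: "f \<in> M" for f
        proof -
          have "K1 * norm f \<le> max K1 K2 * norm f" "K2 * norm f \<le> max K1 K2 * norm f"
            by (intro mult_right_mono; simp)+
          then show ?thesis
            using K12[OF f] norm_bounded[of "T f" y] norm_bounded[of "S f" y] by linarith
        qed
        then show ?thesis by (simp add: D_def)
      qed
      then have "Yc = G" unfolding Yc_def by blast
      then show "G - Yc = {} \<and> Yc = (\<Union>f\<in>M. coz (T f)) \<inter> (\<Union>f\<in>M. coz (S f))"
        by (simp add: G_def)
    qed
  qed
qed

end
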